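(* Let $K$ be a strongly connected simplicial complex. The complete unfolding $\widetilde{a(K)}$ of the anti-prismatic subdivision $a(K)$ is canonically isomorphic to the anti-prismatic subdivision $a(\widetilde{K})$ of the complete unfolding $\widetilde{K}$ as a pseudo-simplicial complex. In particular, $\widetilde{a(K)}$ is a simplicial complex.
   Context: "Canonically" means compatibly with the natural maps: $\widetilde{a(K)}\to a(K)$ (the complete unfolding map) on the one side, and the map $a(\widetilde{K})\to a(K)$ induced by the complete unfolding map $\widetilde{K}\to K$ on the other. $K$ is a locally finite simplicial complex, pure of dimension $d$ (every face lies in a $d$-dimensional face). $d$-dimensional faces are facets, codimension-$1$ faces are ridges; two distinct facets are neighbors if they share a ridge; $V(\sigma)$ is the vertex set of $\sigma$. $K$ is strongly connected if any two facets are joined by a facet path, i.e. a sequence of facets with consecutive ones neighbors. For neighboring facets $\sigma,\tau$ the perspectivity $\langle\sigma,\tau\rangle:V(\sigma)\to V(\tau)$ is the bijection fixing all common vertices and sending the vertex of $\sigma$ not in $\tau$ to the vertex of $\tau$ not in $\sigma$. For a facet path $\gamma=(\sigma_0,\dots,\sigma_n)$ put $\langle\gamma\rangle=\langle\sigma_0,\sigma_1\rangle\cdots\langle\sigma_{n-1},\sigma_n\rangle$ (maps composed left to right) and $\gamma^-=(\sigma_n,\dots,\sigma_0)$. A pseudo-simplicial complex is a quotient of a disjoint union of geometric simplices by identifications given by simplicial isomorphisms between subcomplexes of pairs of the simplices, such that the quotient map is injective on each simplex. Complete unfolding. Fix a facet $\sigma_0$ and a bijective coloring $b_0:V(\sigma_0)\to\{0,\dots,d\}$.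 A coloring of $V(\sigma)$, $\sigma$ a facet, is admissible if it has the form $\langle\eta^-\rangle b_0$ for some facet path $\eta$ from $\sigma_0$ to $\sigma$. Take a copy $(\sigma,b)$ of the simplex $\sigma$ for each facet $\sigma$ and each admissible coloring $b$ of $V(\sigma)$; for neighbors $\sigma,\tau$ glue $(\sigma,b)$ and $(\tau,c)$ by the identity along the common ridge $\rho$ whenever $b$ and $c$ coincide on the vertices of $\rho$. The quotient of the disjoint union by the generated equivalence relation is the pseudo-simplicial complex $\widetilde{K}$ (independent, up to isomorphism, of the choices); the complete unfolding map $\widetilde{K}\to K$ is induced by the affine isomorphisms $(\sigma,b)\to\sigma$. Anti-prismatic subdivision. For a simplicial or pseudo-simplicial complex $J$, $a(J)$ is the simplicial complex whose vertices are all pairs $(\tau,w)$, where $\tau$ is a non-empty face (simplex) of $J$ and $w$ a vertex of $\tau$; a finite set of such pairs is a face if and only if it can be written as $\{(\tau_0,w_0),\dots,(\tau_k,w_k)\}$ with $\tau_0\subseteq\tau_1\subseteq\dots\subseteq\tau_k$ a flag of faces of $J$ (repetitions allowed) and such that $\tau_i\subsetneq\tau_j$ implies $w_j\notin\tau_i$. *)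

theory Defs
  imports Main "HOL-Library.FuncSet"
begin

section \<open>Simplicial complexes\<close>

text \<open>A simplicial complex is the set of its non-empty faces, each given by its vertex set.
  It may be infinite.\<close>

definition simplicial_complex :: "'v set set \<Rightarrow> bool" where
  "simplicial_complex K \<longleftrightarrow>
    (\<forall>\<sigma>\<in>K. finite \<sigma> \<and> \<sigma> \<noteq> {} \<and> (\<forall>\<tau>. \<tau> \<subseteq> \<sigma> \<and> \<tau> \<noteq> {} \<longrightarrow> \<tau> \<in> K))"

definition locally_finite :: "'v set set \<Rightarrow> bool" where
  "locally_finite K \<longleftrightarrow> (\<forall>v. finite {\<sigma> \<in> K. v \<in> \<sigma>})"

definition facets :: "nat \<Rightarrow> 'v set set \<Rightarrow> 'v set set" where
  "facets d K = {\<sigma> \<in> K. card \<sigma> = d + 1}"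

definition pure :: "nat \<Rightarrow> 'v set set \<Rightarrow> bool" where
  "pure d K \<longleftrightarrow> (\<forall>\<tau>\<in>K. \<exists>\<sigma>\<in>facets d K. \<tau> \<subseteq> \<sigma>)"

text \<open>Distinct facets share a ridge iff their intersection has \<open>d\<close> vertices. For \<open>d = 0\<close> the
  ridge is the empty face, so any two distinct vertices are then neighbors.\<close>

definition neighbors :: "nat \<Rightarrow> 'v set set \<Rightarrow> 'v set \<Rightarrow> 'v set \<Rightarrow> bool" where
  "neighbors d K \<sigma> \<tau> \<longleftrightarrow>
    \<sigma> \<in> facets d K \<and> \<tau> \<in> facets d K \<and> \<sigma> \<noteq> \<tau> \<and> card (\<sigma> \<inter> \<tau>) = d"

definition facet_path :: "nat \<Rightarrow> 'v set set \<Rightarrow> 'v set list \<Rightarrow> bool" where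
  "facet_path d K \<gamma> \<longleftrightarrow> \<gamma> \<noteq> [] \<and> set \<gamma> \<subseteq> facets d K \<and> successively (neighbors d K) \<gamma>"

definition strongly_connected :: "nat \<Rightarrow> 'v set set \<Rightarrow> bool" where
  "strongly_connected d K \<longleftrightarrow>
    (\<forall>\<sigma>\<in>facets d K. \<forall>\<tau>\<in>facets d K. \<exists>\<gamma>. facet_path d K \<gamma> \<and> hd \<gamma> = \<sigma> \<and> last \<gamma> = \<tau>)"

section \<open>Perspectivities and admissible colorings\<close>

definition perspectivity :: "'v set \<Rightarrow> 'v set \<Rightarrow> 'v \<Rightarrow> 'v" where
  "perspectivity \<sigma> \<tau> v = (if v \<in> \<tau> then v else the_elem (\<tau> - \<sigma>))"

fun projectivity :: "'v set list \<Rightarrow> 'v \<Rightarrow> 'v" where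
  "projectivity (\<sigma> # \<tau> # \<gamma>) = projectivity (\<tau> # \<gamma>) \<circ> perspectivity \<sigma> \<tau>"
| "projectivity _ = id"

text \<open>Colorings of \<open>\<sigma>\<close> are made extensional by \<^const>\<open>restrict\<close>, so that two of them are equal iff
  they agree on \<open>\<sigma>\<close>. Otherwise \<open>\<sigma>\<close> would get superfluous copies in the unfolding.\<close>

definition admissible ::
    "nat \<Rightarrow> 'v set set \<Rightarrow> 'v set \<Rightarrow> ('v \<Rightarrow> nat) \<Rightarrow> 'v set \<Rightarrow> ('v \<Rightarrow> nat) \<Rightarrow> bool" where
  "admissible d K \<sigma>\<^sub>0 b\<^sub>0 \<sigma> b \<longleftrightarrow>
    (\<exists>\<eta>. facet_path d K \<eta> \<and> hd \<eta> = \<sigma>\<^sub>0 \<and> last \<eta> = \<sigma> \<and>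
         b = restrict (b\<^sub>0 \<circ> projectivity (rev \<eta>)) \<sigma>)"

section \<open>Pseudo-simplicial complexes\<close>

text \<open>The combinatorial data of a pseudo-simplicial complex. Distinct simplices may have the same
  vertices, so the face relation has to be recorded separately.\<close>

record ('f, 'w) pseudo_complex =
  simplices :: "'f set"
  verts :: "'f \<Rightarrow> 'w set"
  face_le :: "'f \<Rightarrow> 'f \<Rightarrow> bool"

definition vertices :: "('f, 'w) pseudo_complex \<Rightarrow> 'w set" where
  "vertices J = (\<Union>s\<in>simplices J. verts J s)"

definition of_complex :: "'v set set \<Rightarrow> ('v set, 'v) pseudo_complex" where
  "of_complex K = \<lparr>simplices = K, verts = (\<lambda>s. s), face_le = (\<subseteq>)\<rparr>"

text \<open>Gluing: a simplex with vertex set \<open>S i\<close> is taken for each \<open>i \<in> I\<close>. An element \<open>(i, j, L, \<phi>)\<close>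
  of \<open>G\<close> identifies the subcomplex \<open>L\<close> of the \<open>i\<close>-th simplex with a subcomplex of the \<open>j\<close>-th one
  by the simplicial isomorphism with vertex map \<open>\<phi>\<close>.\<close>

type_synonym ('i, 'v) identification = "'i \<times> 'i \<times> 'v set set \<times> ('v \<Rightarrow> 'v)"

definition gluing_data ::
    "'i set \<Rightarrow> ('i \<Rightarrow> 'v set) \<Rightarrow> ('i, 'v) identification set \<Rightarrow> bool" where
  "gluing_data I S G \<longleftrightarrow>
    (\<forall>i\<in>I. finite (S i) \<and> S i \<noteq> {}) \<and>
    (\<forall>(i, j, L, \<phi>)\<in>G. i \<in> I \<and> j \<in> I \<and> simplicial_complex L \<and> \<Union>L \<subseteq> S i \<and>
        inj_on \<phi> (\<Union>L) \<and> \<phi> ` \<Union>L \<subseteq> S j)"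

definition vertex_equiv :: "('i, 'v) identification set \<Rightarrow> (('i \<times> 'v) \<times> ('i \<times> 'v)) set" where
  "vertex_equiv G =
    (let R = {((i, v), (j, \<phi> v)) | i j L \<phi> v. (i, j, L, \<phi>) \<in> G \<and> v \<in> \<Union>L} in (R \<union> R\<inverse>)\<^sup>*)"

definition face_equiv ::
    "('i, 'v) identification set \<Rightarrow> (('i \<times> 'v set) \<times> ('i \<times> 'v set)) set" where
  "face_equiv G =
    (let R = {((i, A), (j, \<phi> ` A)) | i j L \<phi> A. (i, j, L, \<phi>) \<in> G \<and> A \<in> L} in (R \<union> R\<inverse>)\<^sup>*)"

definition glued :: "'i set \<Rightarrow> ('i \<Rightarrow> 'v set) \<Rightarrow> ('i, 'v) identification set \<Rightarrow>
    (('i \<times> 'v set) set, ('i \<times> 'v) set) pseudo_complex" where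
  "glued I S G =
    \<lparr>simplices = {(i, A). i \<in> I \<and> A \<subseteq> S i \<and> A \<noteq> {}} // face_equiv G,
     verts = (\<lambda>s. {vertex_equiv G `` {(i, v)} | i v. \<exists>A. (i, A) \<in> s \<and> v \<in> A}),
     face_le = (\<lambda>s t. \<exists>i A B. (i, A) \<in> s \<and> (i, B) \<in> t \<and> A \<subseteq> B)\<rparr>"

text \<open>Injectivity of the quotient map on each simplex. It suffices to look at vertices, as the
  identifications are simplicial.\<close>

definition injective_gluing ::
    "'i set \<Rightarrow> ('i \<Rightarrow> 'v set) \<Rightarrow> ('i, 'v) identification set \<Rightarrow> bool" where
  "injective_gluing I S G \<longleftrightarrow> (\<forall>i\<in>I. inj_on (\<lambda>v. vertex_equiv G `` {(i, v)}) (S i))"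

definition pseudo_iso :: "('f, 'w) pseudo_complex \<Rightarrow> ('g, 'x) pseudo_complex \<Rightarrow>
    ('w \<Rightarrow> 'x) \<Rightarrow> ('f \<Rightarrow> 'g) \<Rightarrow> bool" where
  "pseudo_iso J J' f \<phi> \<longleftrightarrow>
    bij_betw f (vertices J) (vertices J') \<and>
    bij_betw \<phi> (simplices J) (simplices J') \<and>
    (\<forall>s\<in>simplices J. verts J' (\<phi> s) = f ` verts J s) \<and>
    (\<forall>s\<in>simplices J. \<forall>t\<in>simplices J. face_le J' (\<phi> s) (\<phi> t) \<longleftrightarrow> face_le J s t)"

text \<open>A pseudo-simplicial complex is a simplicial complex if its simplices can be replaced by their
  vertex sets.\<close>

definition is_simplicial :: "('f, 'w) pseudo_complex \<Rightarrow> bool" where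
  "is_simplicial J \<longleftrightarrow>
    simplicial_complex (verts J ` simplices J) \<and>
    pseudo_iso J (of_complex (verts J ` simplices J)) (\<lambda>x. x) (verts J)"

section \<open>The complete unfolding\<close>

type_synonym 'v colored_facet = "'v set \<times> ('v \<Rightarrow> nat)"

definition colored_facets ::
    "nat \<Rightarrow> 'v set set \<Rightarrow> 'v set \<Rightarrow> ('v \<Rightarrow> nat) \<Rightarrow> 'v colored_facet set" where
  "colored_facets d K \<sigma>\<^sub>0 b\<^sub>0 = {(\<sigma>, b). \<sigma> \<in> facets d K \<and> admissible d K \<sigma>\<^sub>0 b\<^sub>0 \<sigma> b}"

definition unfolding_gluing ::
    "nat \<Rightarrow> 'v set set \<Rightarrow> 'v set \<Rightarrow> ('v \<Rightarrow> nat) \<Rightarrow> ('v colored_facet, 'v) identification set" where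
  "unfolding_gluing d K \<sigma>\<^sub>0 b\<^sub>0 =
    {((\<sigma>, b), (\<tau>, c), {A. A \<subseteq> \<sigma> \<inter> \<tau> \<and> A \<noteq> {}}, \<lambda>v. v) | \<sigma> b \<tau> c.
      (\<sigma>, b) \<in> colored_facets d K \<sigma>\<^sub>0 b\<^sub>0 \<and> (\<tau>, c) \<in> colored_facets d K \<sigma>\<^sub>0 b\<^sub>0 \<and>
      neighbors d K \<sigma> \<tau> \<and> (\<forall>v\<in>\<sigma> \<inter> \<tau>. b v = c v)}"

definition complete_unfolding :: "nat \<Rightarrow> 'v set set \<Rightarrow> 'v set \<Rightarrow> ('v \<Rightarrow> nat) \<Rightarrow>
    (('v colored_facet \<times> 'v set) set, ('v colored_facet \<times> 'v) set) pseudo_complex" where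
  "complete_unfolding d K \<sigma>\<^sub>0 b\<^sub>0 =
    glued (colored_facets d K \<sigma>\<^sub>0 b\<^sub>0) fst (unfolding_gluing d K \<sigma>\<^sub>0 b\<^sub>0)"

text \<open>The complete unfolding map on vertices and on simplices. All representatives \<open>((\<sigma>, b), v)\<close> of
  a vertex have the same \<open>v\<close>, and likewise for simplices; see \<open>unfold_vertex_class\<close> and
  \<open>unfold_simplex_class\<close> below.\<close>

definition unfold_vertex :: "('v colored_facet \<times> 'v) set \<Rightarrow> 'v" where
  "unfold_vertex x = the_elem (snd ` x)"

definition unfold_simplex :: "('v colored_facet \<times> 'v set) set \<Rightarrow> 'v set" where
  "unfold_simplex s = the_elem (snd ` s)"

lemma vertex_equiv_unfolding_snd:
  assumes "(x, y) \<in> vertex_equiv (unfolding_gluing d K \<sigma>\<^sub>0 b\<^sub>0)"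
  shows "snd x = snd y"
  using assms unfolding vertex_equiv_def Let_def
  by (induction rule: rtrancl_induct) (auto simp: unfolding_gluing_def)

lemma face_equiv_unfolding_snd:
  assumes "(x, y) \<in> face_equiv (unfolding_gluing d K \<sigma>\<^sub>0 b\<^sub>0)"
  shows "snd x = snd y"
  using assms unfolding face_equiv_def Let_def
  by (induction rule: rtrancl_induct) (auto simp: unfolding_gluing_def)

lemma vertex_equiv_refl: "(x, x) \<in> vertex_equiv G"
  by (simp add: vertex_equiv_def Let_def)

lemma face_equiv_refl: "(x, x) \<in> face_equiv G"
  by (simp add: face_equiv_def Let_def)

lemma unfold_vertex_class:
  "unfold_vertex (vertex_equiv (unfolding_gluing d K \<sigma>\<^sub>0 b\<^sub>0) `` {(i, v)}) = v"
proof -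
  have "snd ` (vertex_equiv (unfolding_gluing d K \<sigma>\<^sub>0 b\<^sub>0) `` {(i, v)}) = {v}"
    using vertex_equiv_unfolding_snd[where x = "(i, v)" and d = d and K = K]
      vertex_equiv_refl[of "(i, v)"] by force
  then show ?thesis by (simp add: unfold_vertex_def)
qed

lemma unfold_simplex_class:
  "unfold_simplex (face_equiv (unfolding_gluing d K \<sigma>\<^sub>0 b\<^sub>0) `` {(i, A)}) = A"
proof -
  have "snd ` (face_equiv (unfolding_gluing d K \<sigma>\<^sub>0 b\<^sub>0) `` {(i, A)}) = {A}"
    using face_equiv_unfolding_snd[where x = "(i, A)" and d = d and K = K]
      face_equiv_refl[of "(i, A)"] by force
  then show ?thesis by (simp add: unfold_simplex_def)
qed

lemma unfolding_gluing_data: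
  assumes "simplicial_complex K"
  shows "gluing_data (colored_facets d K \<sigma>\<^sub>0 b\<^sub>0) fst (unfolding_gluing d K \<sigma>\<^sub>0 b\<^sub>0)"
proof -
  have fin: "finite \<sigma>" if "\<sigma> \<in> facets d K" for \<sigma>
    using that assms by (auto simp: facets_def simplicial_complex_def)
  have "\<sigma> \<noteq> {}" if "\<sigma> \<in> facets d K" for \<sigma>
    using that assms by (auto simp: facets_def)
  then have "\<forall>i\<in>colored_facets d K \<sigma>\<^sub>0 b\<^sub>0. finite (fst i) \<and> fst i \<noteq> {}"
    using fin by (auto simp: colored_facets_def)
  moreover have "simplicial_complex {A. A \<subseteq> \<sigma> \<inter> \<tau> \<and> A \<noteq> {}}" if "neighbors d K \<sigma> \<tau>" for \<sigma> \<tau>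
  proof -
    have "finite (\<sigma> \<inter> \<tau>)" using that fin by (simp add: neighbors_def)
    then have "finite A" if "A \<subseteq> \<sigma> \<inter> \<tau>" for A using that by (rule rev_finite_subset)
    then show ?thesis unfolding simplicial_complex_def by blast
  qed
  ultimately show ?thesis
    unfolding gluing_data_def unfolding_gluing_def
    by (intro conjI ballI) (auto simp: inj_on_def)
qed

lemma unfolding_injective:
  "injective_gluing (colored_facets d K \<sigma>\<^sub>0 b\<^sub>0) fst (unfolding_gluing d K \<sigma>\<^sub>0 b\<^sub>0)"
  unfolding injective_gluing_def
proof
  fix i
  show "inj_on (\<lambda>v. vertex_equiv (unfolding_gluing d K \<sigma>\<^sub>0 b\<^sub>0) `` {(i, v)}) (fst i)"
    by (rule inj_on_inverseI[where g = unfold_vertex]) (rule unfold_vertex_class)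
qed

section \<open>The anti-prismatic subdivision\<close>

definition antiprismatic :: "('f, 'w) pseudo_complex \<Rightarrow> ('f \<times> 'w) set set" where
  "antiprismatic J =
    {P. \<exists>(k::nat) \<tau> w. P = {(\<tau> i, w i) | i. i \<le> k} \<and>
      (\<forall>i\<le>k. \<tau> i \<in> simplices J \<and> w i \<in> verts J (\<tau> i)) \<and>
      (\<forall>i j. i \<le> j \<and> j \<le> k \<longrightarrow> face_le J (\<tau> i) (\<tau> j)) \<and>
      (\<forall>i\<le>k. \<forall>j\<le>k. face_le J (\<tau> i) (\<tau> j) \<and> \<tau> i \<noteq> \<tau> j \<longrightarrow> w j \<notin> verts J (\<tau> i))}"

text \<open>The vertex map of the simplicial map between anti-prismatic subdivisions induced by a map
  given by \<open>f\<close> on vertices and by \<open>\<phi>\<close> on simplices.\<close>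

definition antiprismatic_map :: "('w \<Rightarrow> 'x) \<Rightarrow> ('f \<Rightarrow> 'g) \<Rightarrow> 'f \<times> 'w \<Rightarrow> 'g \<times> 'x" where
  "antiprismatic_map f \<phi> = (\<lambda>(\<tau>, w). (\<phi> \<tau>, f w))"

end

theory Submission imports Defs begin

text \<open>
  A facet \<open>P\<close> of \<open>a(K)\<close> consists of pairs \<open>(\<tau>, w)\<close> whose second components are exactly
  the vertices of one facet \<open>\<sigma> = snd ` P\<close> of \<open>K\<close>, each occurring once
  (\<open>facets_antiprismatic_iff\<close>). So \<open>snd\<close> turns a coloring of \<open>\<sigma>\<close> into one of \<open>P\<close>, and it
  carries a perspectivity in \<open>a(K)\<close> to a perspectivity in \<open>K\<close>, or to the identity if both facets of
  \<open>a(K)\<close> lie over the same \<open>\<sigma>\<close>. Since a permutation \<open>\<psi>\<close> of the colors takes one base coloring to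
  the other, the simplices to be glued for the unfolding of \<open>a(K)\<close> correspond to the pairs of a colored
  facet \<open>(\<sigma>, b)\<close> of the unfolding of \<open>K\<close> and a facet \<open>P\<close> of \<open>a(\<sigma>)\<close> (\<open>colored_facets_aK\<close>); those
  are also the facets of \<open>a\<close> applied to the unfolding of \<open>K\<close>.

  It remains to compare the gluings. In an unfolding two copies of a face \<open>A\<close> are identified iff
  their colored facets are joined by a path of neighboring colored facets that all contain \<open>A\<close>.
  The central fact is \<open>reachable_lift_iff\<close>: two lifted colored facets are joined in \<open>a(K)\<close>
  around a face \<open>Q\<close> iff the colored facets below are joined in \<open>K\<close> around the largest face
  \<open>\<Union>(fst ` Q)\<close> of the flag of \<open>Q\<close>. Projecting a path is easy (\<open>glue_lift_down\<close>). To lift one, each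
  step between neighbors \<open>\<sigma>\<close> and \<open>\<sigma>'\<close> lifts to a step through a facet of \<open>a(\<sigma> \<inter> \<sigma>')\<close>
  containing \<open>Q\<close> (\<open>glue_lift_up\<close>), and in between one has to move inside \<open>a(\<sigma>)\<close> around \<open>Q\<close>; this
  is possible because the star of \<open>Q\<close> in the subdivision of a simplex is strongly connected
  (\<open>moves_connected\<close>).

  Sending the class of \<open>(\<tau>, w)\<close> in the copy \<open>(P, b)\<close> to the pair of the classes of \<open>\<tau>\<close> and of \<open>w\<close> in
  the copy \<open>(\<sigma>, b)\<close> is then well defined and injective, and it is compatible with faces and with
  the maps to \<open>a(K)\<close>.
\<close>

section \<open>Unfoldings as reachability classes of colored facets\<close>

definition coloring :: "nat \<Rightarrow> 'v set \<Rightarrow> ('v \<Rightarrow> nat) \<Rightarrow> bool" where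
  "coloring d \<sigma> b \<longleftrightarrow> b \<in> extensional \<sigma> \<and> bij_betw b \<sigma> {0..d}"

text \<open>Gluing steps between copies of facets, restricted to those along ridges that contain \<open>A\<close>.
  Classes of faces and vertices become reachability classes of this relation, which makes no
  mention of admissibility: that is itself reachability, for \<open>A = {}\<close>.\<close>

definition glue :: "nat \<Rightarrow> 'v set set \<Rightarrow> 'v set \<Rightarrow> 'v colored_facet rel" where
  "glue d K A = {((\<sigma>, b), (\<tau>, c)) | \<sigma> b \<tau> c. neighbors d K \<sigma> \<tau> \<and> A \<subseteq> \<sigma> \<inter> \<tau> \<and>
      coloring d \<sigma> b \<and> coloring d \<tau> c \<and> (\<forall>v\<in>\<sigma> \<inter> \<tau>. b v = c v)}"

lemma finite_facet: "\<sigma> \<in> facets d K \<Longrightarrow> finite \<sigma>"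
  by (auto simp: facets_def intro: card_ge_0_finite)

lemma neighbors_sym: "neighbors d K \<sigma> \<tau> \<longleftrightarrow> neighbors d K \<tau> \<sigma>"
  by (auto simp: neighbors_def Int_commute)

lemma in_glue_iff: "(i, j) \<in> glue d K A \<longleftrightarrow> neighbors d K (fst i) (fst j) \<and> A \<subseteq> fst i \<inter> fst j \<and>
    coloring d (fst i) (snd i) \<and> coloring d (fst j) (snd j) \<and> (\<forall>v\<in>fst i \<inter> fst j. snd i v = snd j v)"
  by (cases i; cases j) (simp add: glue_def)

lemma glue_symmetric: "(i, j) \<in> glue d K A \<longleftrightarrow> (j, i) \<in> glue d K A"
  unfolding glue_def by (auto simp: neighbors_sym Int_commute)

lemma glue_sym: "(i, j) \<in> (glue d K A)\<^sup>* \<Longrightarrow> (j, i) \<in> (glue d K A)\<^sup>*"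
  using sym_rtrancl[of "glue d K A"] glue_symmetric by (metis symI symD)

text \<open>A path around a face is also a path around each of its subfaces.\<close>

lemma glue_antimono: "A \<subseteq> B \<Longrightarrow> (i, j) \<in> (glue d K B)\<^sup>* \<Longrightarrow> (i, j) \<in> (glue d K A)\<^sup>*"
  using rtrancl_mono[of "glue d K B" "glue d K A"] by (fastforce simp: glue_def)

text \<open>The last color is forced. This replaces all computation with perspectivities: the coloring of a
  facet is determined by that of a neighbor through agreement on the common ridge.\<close>

lemma bij_betw_eq_if_agree_off_one:
  assumes bc: "bij_betw b \<sigma> X" "bij_betw c \<sigma> X"
    and S: "S \<subseteq> \<sigma>" "finite \<sigma>" "card \<sigma> = Suc (card S)"
    and eq: "\<And>v. v \<in> S \<Longrightarrow> b v = c v" and v: "v \<in> \<sigma>"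
  shows "b v = c v"
proof (cases "v \<in> S")
  case False
  have "\<sigma> = insert v S"
    using S v False by (metis card_insert_disjoint card_subset_eq finite_subset insert_subset)
  then have "X = insert (b v) (b ` S)" "X = insert (c v) (b ` S)" "b v \<notin> b ` S" "c v \<notin> b ` S"
    using bc eq False unfolding bij_betw_def by (auto simp: image_iff)
  then show ?thesis by blast
qed (rule eq)

lemma coloring_eq_if_agree_off_one:
  assumes "coloring d \<sigma> b" "coloring d \<sigma> c" "S \<subseteq> \<sigma>" "card \<sigma> = d + 1" "card S = d"
    and "\<And>v. v \<in> S \<Longrightarrow> b v = c v"
  shows "b = c"
proof
  fix v
  have "finite \<sigma>" using assms(4) by (auto intro: card_ge_0_finite)
  then have "b v = c v" if "v \<in> \<sigma>"
    using bij_betw_eq_if_agree_off_one[of b \<sigma> "{0..d}" c S v] assms that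
    by (auto simp: coloring_def)
  then show "b v = c v"
    using assms(1,2) by (cases "v \<in> \<sigma>") (auto simp: coloring_def extensional_def)
qed

lemma perspectivity_bij:
  assumes "neighbors d K \<sigma> \<tau>"
  shows "bij_betw (perspectivity \<tau> \<sigma>) \<tau> \<sigma>"
proof -
  have fin: "finite \<sigma>" "finite \<tau>" and card: "card \<sigma> = d + 1" "card \<tau> = d + 1" "card (\<sigma> \<inter> \<tau>) = d"
    using assms finite_facet by (auto simp: neighbors_def facets_def)
  have "card (\<sigma> - \<tau>) = 1" "card (\<tau> - \<sigma>) = 1"
    using card fin by (simp_all add: card_Diff_subset_Int Int_commute)
  then obtain v u where vu: "\<sigma> - \<tau> = {v}" "\<tau> - \<sigma> = {u}" by (auto simp: card_1_singleton_iff)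
  then have mem: "v \<in> \<sigma>" "v \<notin> \<tau>" "u \<in> \<tau>" "u \<notin> \<sigma>"
      "\<And>x. x \<in> \<sigma> \<Longrightarrow> x \<notin> \<tau> \<Longrightarrow> x = v" "\<And>x. x \<in> \<tau> \<Longrightarrow> x \<notin> \<sigma> \<Longrightarrow> x = u"
    by blast+
  have p: "perspectivity \<tau> \<sigma> x = (if x \<in> \<sigma> then x else v)" for x
    by (simp add: perspectivity_def vu)
  have "inj_on (perspectivity \<tau> \<sigma>) \<tau>"
    by (rule inj_onI) (metis p mem(2) mem(6))
  moreover have "perspectivity \<tau> \<sigma> ` \<tau> = \<sigma>"
  proof
    show "perspectivity \<tau> \<sigma> ` \<tau> \<subseteq> \<sigma>" using mem(1) by (auto simp: p)
    show "\<sigma> \<subseteq> perspectivity \<tau> \<sigma> ` \<tau>" by (metis image_eqI mem(3,4,5) p subsetI)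
  qed
  ultimately show ?thesis by (simp add: bij_betw_def)
qed

lemma glue_iff_perspectivity:
  assumes "neighbors d K \<sigma> \<tau>" "coloring d \<sigma> b"
  shows "((\<sigma>, b), (\<tau>, c)) \<in> glue d K {} \<longleftrightarrow> c = restrict (b \<circ> perspectivity \<tau> \<sigma>) \<tau>"
proof -
  define c' where "c' = restrict (b \<circ> perspectivity \<tau> \<sigma>) \<tau>"
  have "bij_betw (b \<circ> perspectivity \<tau> \<sigma>) \<tau> {0..d}"
    using perspectivity_bij[OF assms(1)] assms(2) by (auto simp: coloring_def intro: bij_betw_trans)
  then have c': "coloring d \<tau> c'"
    by (auto simp: coloring_def c'_def cong: bij_betw_cong)
  have agree: "b v = c' v" if "v \<in> \<sigma> \<inter> \<tau>" for v
    using that by (simp add: c'_def perspectivity_def)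
  have "c = c'" if "((\<sigma>, b), (\<tau>, c)) \<in> glue d K {}"
    using coloring_eq_if_agree_off_one[of d \<tau> c c' "\<sigma> \<inter> \<tau>"] that c' agree assms(1)
    by (auto simp: glue_def neighbors_def facets_def)
  moreover have "((\<sigma>, b), (\<tau>, c')) \<in> glue d K {}"
    using assms c' agree by (auto simp: glue_def)
  ultimately show ?thesis unfolding c'_def by blast
qed

lemma glue_preserves_coloring:
  assumes "(i, j) \<in> (glue d K A)\<^sup>*" "fst i \<in> facets d K" "coloring d (fst i) (snd i)"
  shows "fst j \<in> facets d K \<and> coloring d (fst j) (snd j)"
  using assms by (induction rule: rtrancl_induct) (auto simp: glue_def neighbors_def)

lemma coloring_restrict: "bij_betw b \<sigma> {0..d} \<Longrightarrow> coloring d \<sigma> (restrict b \<sigma>)"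
  by (auto simp: coloring_def cong: bij_betw_cong)

text \<open>Appending a facet to a path composes its projectivity, read backwards, with one more
  perspectivity, that is, with one gluing step.\<close>

lemma colored_facets_eq_reachable:
  assumes \<sigma>\<^sub>0: "\<sigma>\<^sub>0 \<in> facets d K" and b\<^sub>0: "bij_betw b\<^sub>0 \<sigma>\<^sub>0 {0..d}"
  shows "colored_facets d K \<sigma>\<^sub>0 b\<^sub>0 = (glue d K {})\<^sup>* `` {(\<sigma>\<^sub>0, restrict b\<^sub>0 \<sigma>\<^sub>0)}"
proof -
  let ?i = "(\<sigma>\<^sub>0, restrict b\<^sub>0 \<sigma>\<^sub>0)"
  let ?col = "\<lambda>\<eta>. (last \<eta>, restrict (b\<^sub>0 \<circ> projectivity (rev \<eta>)) (last \<eta>))"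
  have colored: "fst j \<in> facets d K \<and> coloring d (fst j) (snd j)"
    if "(?i, j) \<in> (glue d K {})\<^sup>*" for j
    using glue_preserves_coloring[OF that] \<sigma>\<^sub>0 coloring_restrict[OF b\<^sub>0] by simp
  have extend: "?col (\<eta> @ [\<tau>]) = (\<tau>, restrict (snd (?col \<eta>) \<circ> perspectivity \<tau> (last \<eta>)) \<tau>)"
    if "\<eta> \<noteq> []" "neighbors d K (last \<eta>) \<tau>" for \<eta> \<tau>
  proof -
    obtain \<eta>' where \<eta>: "rev \<eta> = last \<eta> # \<eta>'"
      using \<open>\<eta> \<noteq> []\<close> by (cases \<eta> rule: rev_cases) auto
    have "perspectivity \<tau> (last \<eta>) v \<in> last \<eta>" if "v \<in> \<tau>" for v
      using perspectivity_bij[OF \<open>neighbors d K (last \<eta>) \<tau>\<close>] that by (auto simp: bij_betw_def)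
    then show ?thesis by (auto simp: \<eta> fun_eq_iff restrict_def)
  qed
  have "(?i, ?col \<eta>) \<in> (glue d K {})\<^sup>*" if "facet_path d K \<eta>" "hd \<eta> = \<sigma>\<^sub>0" for \<eta>
    using that
  proof (induction \<eta> rule: rev_induct)
    case (snoc \<tau> \<eta>)
    show ?case
    proof (cases "\<eta> = []")
      case False
      then have nb: "neighbors d K (last \<eta>) \<tau>" and "facet_path d K \<eta>" "hd \<eta> = \<sigma>\<^sub>0"
        using snoc.prems by (auto simp: facet_path_def successively_append_iff)
      then have "(?i, ?col \<eta>) \<in> (glue d K {})\<^sup>*" by (intro snoc.IH)
      moreover from this have "coloring d (last \<eta>) (snd (?col \<eta>))" using colored by fastforce
      then have "(?col \<eta>, ?col (\<eta> @ [\<tau>])) \<in> glue d K {}"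
        unfolding extend[OF False nb] using glue_iff_perspectivity[OF nb] by simp
      ultimately show ?thesis by (meson rtrancl.rtrancl_into_rtrancl)
    qed (use snoc in auto)
  qed (simp add: facet_path_def)
  moreover have "\<exists>\<eta>. facet_path d K \<eta> \<and> hd \<eta> = \<sigma>\<^sub>0 \<and> ?col \<eta> = j"
    if "(?i, j) \<in> (glue d K {})\<^sup>*" for j
    using that
  proof (induction rule: rtrancl_induct)
    case base
    have "facet_path d K [\<sigma>\<^sub>0]" using \<sigma>\<^sub>0 by (simp add: facet_path_def)
    then show ?case by force
  next
    case (step j k)
    then obtain \<eta> where \<eta>: "facet_path d K \<eta>" "hd \<eta> = \<sigma>\<^sub>0" "?col \<eta> = j" by blast
    obtain \<tau> c where k: "k = (\<tau>, c)" by force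
    have nb: "neighbors d K (last \<eta>) \<tau>" and "\<eta> \<noteq> []"
      using step(2) \<eta>(1) k by (auto simp: glue_def facet_path_def \<eta>(3)[symmetric])
    then have "facet_path d K (\<eta> @ [\<tau>])"
      using \<eta>(1) by (auto simp: facet_path_def successively_append_iff neighbors_def)
    moreover have "?col (\<eta> @ [\<tau>]) = k"
    proof -
      have "j = (last \<eta>, snd (?col \<eta>))" by (simp only: \<eta>(3)[symmetric] snd_conv)
      then have "c = restrict (snd (?col \<eta>) \<circ> perspectivity \<tau> (last \<eta>)) \<tau>"
        using glue_iff_perspectivity[OF nb, of "snd (?col \<eta>)" c] colored[OF step(1)] step(2) k
        by (metis fst_conv snd_conv)
      then show ?thesis unfolding extend[OF \<open>\<eta> \<noteq> []\<close> nb] k by simp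
    qed
    ultimately show ?case using \<eta>(2) \<open>\<eta> \<noteq> []\<close> by (intro exI[of _ "\<eta> @ [\<tau>]"]) auto
  qed
  ultimately show ?thesis
    using colored by (fastforce simp: colored_facets_def admissible_def)
qed

text \<open>The equivalence classes of the gluing, described without reference to a base coloring.\<close>

definition face_class ::
    "nat \<Rightarrow> 'v set set \<Rightarrow> 'v colored_facet \<Rightarrow> 'v set \<Rightarrow> ('v colored_facet \<times> 'v set) set" where
  "face_class d K i A = (glue d K A)\<^sup>* `` {i} \<times> {A}"

definition vertex_class ::
    "nat \<Rightarrow> 'v set set \<Rightarrow> 'v colored_facet \<Rightarrow> 'v \<Rightarrow> ('v colored_facet \<times> 'v) set" where
  "vertex_class d K i v = (glue d K {v})\<^sup>* `` {i} \<times> {v}"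

lemma face_class_eq_iff:
  "face_class d K i A = face_class d K j B \<longleftrightarrow> A = B \<and> (i, j) \<in> (glue d K A)\<^sup>*"
proof
  assume "face_class d K i A = face_class d K j B"
  moreover have "(j, B) \<in> face_class d K j B" by (simp add: face_class_def)
  ultimately show "A = B \<and> (i, j) \<in> (glue d K A)\<^sup>*" by (auto simp: face_class_def)
next
  assume "A = B \<and> (i, j) \<in> (glue d K A)\<^sup>*"
  then show "face_class d K i A = face_class d K j B"
    using glue_sym[of i j d K A] by (auto simp: face_class_def)
qed

lemma vertex_class_eq_iff:
  "vertex_class d K i v = vertex_class d K j w \<longleftrightarrow> v = w \<and> (i, j) \<in> (glue d K {v})\<^sup>*"
proof
  assume "vertex_class d K i v = vertex_class d K j w"
  moreover have "(j, w) \<in> vertex_class d K j w" by (simp add: vertex_class_def)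
  ultimately show "v = w \<and> (i, j) \<in> (glue d K {v})\<^sup>*" by (auto simp: vertex_class_def)
next
  assume "v = w \<and> (i, j) \<in> (glue d K {v})\<^sup>*"
  then show "vertex_class d K i v = vertex_class d K j w"
    using glue_sym[of i j d K "{v}"] by (auto simp: vertex_class_def)
qed

lemma unfold_simplex_face_class: "unfold_simplex (face_class d K i A) = A"
proof -
  have "snd ` face_class d K i A = {A}" by (auto simp: face_class_def image_iff)
  then show ?thesis by (simp add: unfold_simplex_def)
qed

lemma unfold_vertex_vertex_class: "unfold_vertex (vertex_class d K i v) = v"
proof -
  have "snd ` vertex_class d K i v = {v}" by (auto simp: vertex_class_def image_iff)
  then show ?thesis by (simp add: unfold_vertex_def)
qed

locale based_unfolding =
  fixes d :: nat and K :: "'v set set" and \<sigma>\<^sub>0 :: "'v set" and b\<^sub>0 :: "'v \<Rightarrow> nat"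
  assumes base_facet: "\<sigma>\<^sub>0 \<in> facets d K" and base_coloring: "bij_betw b\<^sub>0 \<sigma>\<^sub>0 {0..d}"
begin

abbreviation "C \<equiv> colored_facets d K \<sigma>\<^sub>0 b\<^sub>0"
abbreviation "U \<equiv> complete_unfolding d K \<sigma>\<^sub>0 b\<^sub>0"

lemmas C_eq = colored_facets_eq_reachable[OF base_facet base_coloring]

lemma C_coloring: "i \<in> C \<Longrightarrow> fst i \<in> facets d K \<and> coloring d (fst i) (snd i)"
  using glue_preserves_coloring[of "(\<sigma>\<^sub>0, restrict b\<^sub>0 \<sigma>\<^sub>0)" i d K "{}"]
    base_facet coloring_restrict[OF base_coloring] by (simp add: C_eq)

lemma C_glue_closed: "i \<in> C \<Longrightarrow> (i, j) \<in> (glue d K A)\<^sup>* \<Longrightarrow> j \<in> C"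
  using glue_antimono[of "{}" A i j d K] by (auto simp: C_eq)

text \<open>Neighbors of an admissible copy that agree with it on the ridge are admissible, so gluing
  steps stay within the copies that are taken.\<close>

lemma gluing_iff: "(i, j, L, \<phi>) \<in> unfolding_gluing d K \<sigma>\<^sub>0 b\<^sub>0 \<longleftrightarrow>
    i \<in> C \<and> (i, j) \<in> glue d K {} \<and> L = {A. A \<subseteq> fst i \<inter> fst j \<and> A \<noteq> {}} \<and> \<phi> = (\<lambda>v. v)"
proof -
  have "j \<in> C" if "i \<in> C" "(i, j) \<in> glue d K {}" using that C_glue_closed by blast
  then show ?thesis
    using C_coloring[of i] C_coloring[of j] unfolding unfolding_gluing_def glue_def
    by (cases i; cases j) auto
qed

lemma glue_iff: "(i, j) \<in> glue d K A \<longleftrightarrow> (i, j) \<in> glue d K {} \<and> A \<subseteq> fst i \<inter> fst j"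
  by (auto simp: glue_def)

lemma face_equiv_class:
  assumes "i \<in> C" "A \<noteq> {}"
  shows "face_equiv (unfolding_gluing d K \<sigma>\<^sub>0 b\<^sub>0) `` {(i, A)} = face_class d K i A"
proof -
  define R where "R = {((i, A), (j, \<phi> ` A)) | i j L \<phi> A.
      (i, j, L, \<phi>) \<in> unfolding_gluing d K \<sigma>\<^sub>0 b\<^sub>0 \<and> A \<in> L}"
  have R_iff: "((i, A), (j, B)) \<in> R \<longleftrightarrow> i \<in> C \<and> B = A \<and> A \<noteq> {} \<and> (i, j) \<in> glue d K A" for i j A B
    unfolding R_def glue_iff[of i j A] by (cases i; cases j) (auto simp: gluing_iff)
  have R: "((i, A), (j, B)) \<in> R \<union> R\<inverse> \<longleftrightarrow> B = A \<and> (i, j) \<in> glue d K A"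
    if "i \<in> C" "A \<noteq> {}" for i j A B
    using that C_glue_closed[of i j A] glue_symmetric[of i j d K A] by (auto simp: R_iff)
  have "x \<in> face_class d K i A" if "((i, A), x) \<in> (R \<union> R\<inverse>)\<^sup>*" for x
    using that
  proof (induction rule: rtrancl_induct)
    case (step y z)
    then obtain j where j: "y = (j, A)" "(i, j) \<in> (glue d K A)\<^sup>*" by (auto simp: face_class_def)
    then show ?case
      using step(2) R[OF C_glue_closed[OF assms(1) j(2)] assms(2), of "fst z" "snd z"]
      by (cases z) (auto simp: face_class_def)
  qed (simp add: face_class_def)
  moreover have "((i, A), (j, A)) \<in> (R \<union> R\<inverse>)\<^sup>*" if "(i, j) \<in> (glue d K A)\<^sup>*" for j
    using that
  proof (induction rule: rtrancl_induct)
    case (step j k)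
    then have "((j, A), (k, A)) \<in> R \<union> R\<inverse>"
      using R[OF C_glue_closed[OF assms(1) step(1)] assms(2), of k A] by simp
    then show ?case using step(3) by (meson rtrancl.rtrancl_into_rtrancl)
  qed simp
  ultimately show ?thesis
    unfolding face_equiv_def Let_def R_def[symmetric] by (auto simp: face_class_def)
qed

lemma vertex_equiv_class:
  assumes "i \<in> C"
  shows "vertex_equiv (unfolding_gluing d K \<sigma>\<^sub>0 b\<^sub>0) `` {(i, v)} = vertex_class d K i v"
proof -
  define R where "R = {((i, v), (j, \<phi> v)) | i j L \<phi> v.
      (i, j, L, \<phi>) \<in> unfolding_gluing d K \<sigma>\<^sub>0 b\<^sub>0 \<and> v \<in> \<Union>L}"
  have R_iff: "((i, v), (j, w)) \<in> R \<longleftrightarrow> i \<in> C \<and> w = v \<and> (i, j) \<in> glue d K {v}" for i j v w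
    unfolding R_def glue_iff[of i j "{v}"]
    by (cases i; cases j) (auto simp: gluing_iff intro!: exI[of _ "{v}"])
  have R: "((i, v), (j, w)) \<in> R \<union> R\<inverse> \<longleftrightarrow> w = v \<and> (i, j) \<in> glue d K {v}"
    if "i \<in> C" for i j v w
    using that C_glue_closed[of i j "{v}"] glue_symmetric[of i j d K "{v}"] by (auto simp: R_iff)
  have "x \<in> vertex_class d K i v" if "((i, v), x) \<in> (R \<union> R\<inverse>)\<^sup>*" for x
    using that
  proof (induction rule: rtrancl_induct)
    case (step y z)
    then obtain j where j: "y = (j, v)" "(i, j) \<in> (glue d K {v})\<^sup>*" by (auto simp: vertex_class_def)
    then show ?case
      using step(2) R[OF C_glue_closed[OF assms(1) j(2)], of v "fst z" "snd z"]
      by (cases z) (auto simp: vertex_class_def)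
  qed (simp add: vertex_class_def)
  moreover have "((i, v), (j, v)) \<in> (R \<union> R\<inverse>)\<^sup>*" if "(i, j) \<in> (glue d K {v})\<^sup>*" for j
    using that
  proof (induction rule: rtrancl_induct)
    case (step j k)
    then have "((j, v), (k, v)) \<in> R \<union> R\<inverse>"
      using R[OF C_glue_closed[OF assms(1) step(1)], of v k v] by simp
    then show ?case using step(3) by (meson rtrancl.rtrancl_into_rtrancl)
  qed simp
  ultimately show ?thesis
    unfolding vertex_equiv_def Let_def R_def[symmetric] by (auto simp: vertex_class_def)
qed

lemma simplices_unfolding: "simplices U = {face_class d K i A | i A. i \<in> C \<and> A \<subseteq> fst i \<and> A \<noteq> {}}"
proof -
  let ?S = "{(i, A). i \<in> C \<and> A \<subseteq> fst i \<and> A \<noteq> {}}"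
  have "simplices U = (\<lambda>x. face_equiv (unfolding_gluing d K \<sigma>\<^sub>0 b\<^sub>0) `` {x}) ` ?S"
    by (auto simp: complete_unfolding_def glued_def quotient_def)
  also have "\<dots> = (\<lambda>(i, A). face_class d K i A) ` ?S"
    using face_equiv_class by (intro image_cong) (auto simp only: mem_Collect_eq split: prod.splits)
  also have "\<dots> = {face_class d K i A | i A. i \<in> C \<and> A \<subseteq> fst i \<and> A \<noteq> {}}"
    by (auto simp: image_iff) blast+
  finally show ?thesis .
qed

lemma verts_unfolding:
  assumes "i \<in> C"
  shows "verts U (face_class d K i A) = vertex_class d K i ` A"
proof -
  have eq: "vertex_equiv (unfolding_gluing d K \<sigma>\<^sub>0 b\<^sub>0) `` {(j, v)} = vertex_class d K i v"
    if "(i, j) \<in> (glue d K A)\<^sup>*" "v \<in> A" for j v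
    using that vertex_equiv_class[OF C_glue_closed[OF assms that(1)]]
      glue_antimono[of "{v}" A i j d K]
    by (auto simp: vertex_class_eq_iff intro: glue_sym)
  have "verts U (face_class d K i A) =
      {vertex_equiv (unfolding_gluing d K \<sigma>\<^sub>0 b\<^sub>0) `` {(j, v)} | j v. (i, j) \<in> (glue d K A)\<^sup>* \<and> v \<in> A}"
    unfolding complete_unfolding_def glued_def face_class_def by auto
  also have "\<dots> = vertex_class d K i ` A"
  proof (intro equalityI subsetI)
    fix x assume "x \<in> vertex_class d K i ` A"
    then obtain v where "v \<in> A" "x = vertex_class d K i v" by blast
    then show "x \<in> {vertex_equiv (unfolding_gluing d K \<sigma>\<^sub>0 b\<^sub>0) `` {(j, v)} | j v.
        (i, j) \<in> (glue d K A)\<^sup>* \<and> v \<in> A}"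
      using eq[of i v] by blast
  qed (use eq in blast)
  finally show ?thesis .
qed

lemma face_le_unfolding:
  "face_le U (face_class d K i A) (face_class d K j B) \<longleftrightarrow> A \<subseteq> B \<and> (i, j) \<in> (glue d K A)\<^sup>*"
proof
  assume "face_le U (face_class d K i A) (face_class d K j B)"
  then obtain k where "A \<subseteq> B" "(i, k) \<in> (glue d K A)\<^sup>*" "(j, k) \<in> (glue d K B)\<^sup>*"
    by (auto simp: complete_unfolding_def glued_def face_class_def)
  then show "A \<subseteq> B \<and> (i, j) \<in> (glue d K A)\<^sup>*"
    by (meson glue_antimono glue_sym rtrancl_trans)
next
  assume "A \<subseteq> B \<and> (i, j) \<in> (glue d K A)\<^sup>*"
  then have "(j, A) \<in> face_class d K i A" "(j, B) \<in> face_class d K j B" "A \<subseteq> B"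
    by (auto simp: face_class_def)
  then show "face_le U (face_class d K i A) (face_class d K j B)"
    unfolding complete_unfolding_def glued_def by (cases j) auto
qed

end

section \<open>Faces and facets of the anti-prismatic subdivision\<close>

text \<open>Faces of the anti-prismatic subdivision without an enumeration. The empty set is included, as the
  faces of a facet that are kept fixed below may be empty.\<close>

definition prismatic :: "('v set \<times> 'v) set \<Rightarrow> bool" where
  "prismatic Q \<longleftrightarrow> finite Q \<and> (\<forall>p\<in>Q. snd p \<in> fst p) \<and>
    (\<forall>p\<in>Q. \<forall>q\<in>Q. fst p \<subseteq> fst q \<or> fst q \<subseteq> fst p) \<and>
    (\<forall>p\<in>Q. \<forall>q\<in>Q. fst p \<subset> fst q \<longrightarrow> snd q \<notin> fst p)"

lemma prismaticD:
  assumes "prismatic Q"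
  shows "finite Q" "p \<in> Q \<Longrightarrow> snd p \<in> fst p"
    "p \<in> Q \<Longrightarrow> q \<in> Q \<Longrightarrow> fst p \<subseteq> fst q \<or> fst q \<subseteq> fst p"
    "p \<in> Q \<Longrightarrow> q \<in> Q \<Longrightarrow> fst p \<subset> fst q \<Longrightarrow> snd q \<notin> fst p"
  using assms unfolding prismatic_def by blast+

lemma prismatic_subset: "prismatic P \<Longrightarrow> Q \<subseteq> P \<Longrightarrow> prismatic Q"
  unfolding prismatic_def using finite_subset by (metis subsetD)

text \<open>Of two pairs with the same \<open>w\<close> and nested faces \<open>\<tau>\<close>, the larger face would have \<open>w\<close> in the
  smaller one.\<close>

lemma prismatic_inj_on_snd:
  assumes "prismatic P"
  shows "inj_on snd P"
proof (rule inj_onI)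
  fix p q assume "p \<in> P" "q \<in> P" "snd p = snd q"
  then have "fst p = fst q" using prismaticD(2-4)[OF assms] by (metis psubsetI)
  then show "p = q" using \<open>snd p = snd q\<close> by (simp add: prod_eq_iff)
qed

text \<open>Sorting the pairs by the cardinality of the first component.\<close>

lemma prismatic_enumerate:
  assumes "prismatic Q" "Q \<noteq> {}" "\<And>p. p \<in> Q \<Longrightarrow> finite (fst p)"
  obtains k :: nat and \<tau> w where "Q = {(\<tau> i, w i) | i. i \<le> k}"
    "\<And>i j. i \<le> j \<Longrightarrow> j \<le> k \<Longrightarrow> \<tau> i \<subseteq> \<tau> j"
proof -
  obtain ys where ys: "set ys = Q"
    using finite_list[OF prismaticD(1)[OF assms(1)]] by blast
  define xs where "xs = sort_key (\<lambda>p. card (fst p)) ys"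
  have xs: "set xs = Q" "sorted (map (\<lambda>p. card (fst p)) xs)"
    using ys unfolding xs_def by auto
  then have "xs \<noteq> []" using assms(2) by auto
  have *: "fst (xs ! i) \<subseteq> fst (xs ! j)" if "i \<le> j" "j \<le> length xs - 1" for i j
  proof -
    have len: "j < length xs" "i < length xs" using that \<open>xs \<noteq> []\<close> by (cases xs; auto)+
    then have mem: "xs ! i \<in> Q" "xs ! j \<in> Q" using xs(1) by auto
    have "card (fst (xs ! i)) \<le> card (fst (xs ! j))"
      using sorted_nth_mono[OF xs(2) that(1)] len by simp
    moreover have "fst (xs ! i) \<subseteq> fst (xs ! j) \<or> fst (xs ! j) \<subseteq> fst (xs ! i)"
      using prismaticD(3)[OF assms(1)] mem by blast
    ultimately show ?thesis using assms(3)[OF mem(1)] by (metis card_seteq order_refl)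
  qed
  have "Q = {(fst (xs ! i), snd (xs ! i)) | i. i \<le> length xs - 1}"
    unfolding xs(1)[symmetric] set_conv_nth using \<open>xs \<noteq> []\<close> by (cases xs) (auto simp: less_Suc_eq_le)
  then show ?thesis using * by (rule that)
qed

lemma antiprismatic_iff:
  assumes "simplicial_complex K"
  shows "Q \<in> antiprismatic (of_complex K) \<longleftrightarrow> prismatic Q \<and> Q \<noteq> {} \<and> fst ` Q \<subseteq> K"
proof
  assume "Q \<in> antiprismatic (of_complex K)"
  then obtain k :: nat and \<tau> w where Q: "Q = {(\<tau> i, w i) | i. i \<le> k}"
    and *: "\<forall>i\<le>k. \<tau> i \<in> K \<and> w i \<in> \<tau> i" "\<forall>i j. i \<le> j \<and> j \<le> k \<longrightarrow> \<tau> i \<subseteq> \<tau> j"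
      "\<forall>i\<le>k. \<forall>j\<le>k. \<tau> i \<subseteq> \<tau> j \<and> \<tau> i \<noteq> \<tau> j \<longrightarrow> w j \<notin> \<tau> i"
    by (auto simp: antiprismatic_def of_complex_def)
  have "\<tau> i \<subseteq> \<tau> j \<or> \<tau> j \<subseteq> \<tau> i" if "i \<le> k" "j \<le> k" for i j
    using *(2) that by (metis nle_le)
  moreover have "Q = (\<lambda>i. (\<tau> i, w i)) ` {..k}" using Q by auto
  ultimately show "prismatic Q \<and> Q \<noteq> {} \<and> fst ` Q \<subseteq> K"
    using * by (auto simp: prismatic_def psubset_eq)
next
  assume Q: "prismatic Q \<and> Q \<noteq> {} \<and> fst ` Q \<subseteq> K"
  then have fin: "finite (fst p)" if "p \<in> Q" for p
    using assms that by (auto simp: simplicial_complex_def)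
  then obtain k :: nat and \<tau> w where eq: "Q = {(\<tau> i, w i) | i. i \<le> k}"
    and mono: "\<And>i j. i \<le> j \<Longrightarrow> j \<le> k \<Longrightarrow> \<tau> i \<subseteq> \<tau> j"
    using prismatic_enumerate[of Q thesis] Q fin by blast
  have mem: "(\<tau> i, w i) \<in> Q" if "i \<le> k" for i using eq that by blast
  have "w i \<in> \<tau> i \<and> \<tau> i \<in> K" if "i \<le> k" for i
    using prismaticD(2)[OF _ mem[OF that]] mem[OF that] Q by force
  moreover have "w j \<notin> \<tau> i" if "i \<le> k" "j \<le> k" "\<tau> i \<subseteq> \<tau> j" "\<tau> i \<noteq> \<tau> j" for i j
    using prismaticD(4)[OF _ mem[OF that(1)] mem[OF that(2)]] that Q by (simp add: psubset_eq)
  ultimately show "Q \<in> antiprismatic (of_complex K)"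
    unfolding antiprismatic_def of_complex_def using eq mono
    by (intro CollectI exI[of _ k] exI[of _ \<tau>] exI[of _ w]) auto
qed

lemma prismatic_top:
  assumes "prismatic Q" "Q \<noteq> {}"
  obtains q where "q \<in> Q" "\<Union>(fst ` Q) = fst q"
proof -
  have "\<exists>q\<in>Q. \<forall>p\<in>Q. fst p \<subseteq> fst q"
    using prismaticD(1)[OF assms(1)] assms(2) prismaticD(3)[OF assms(1)]
  proof (induction Q rule: finite_ne_induct)
    case (insert x F)
    then obtain q where "q \<in> F" "\<forall>p\<in>F. fst p \<subseteq> fst q" by (metis insertCI)
    moreover have "fst x \<subseteq> fst q \<or> fst q \<subseteq> fst x" using insert.prems calculation(1) by blast
    ultimately show ?case by (metis insert_iff order_refl order_trans)
  qed simp
  then obtain q where q: "q \<in> Q" "\<And>p. p \<in> Q \<Longrightarrow> fst p \<subseteq> fst q" by blast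
  then have "\<Union>(fst ` Q) = fst q" by blast
  then show ?thesis using that q(1) by blast
qed

definition down :: "'v set \<Rightarrow> ('v \<Rightarrow> nat) \<Rightarrow> 'v \<Rightarrow> 'v set" where
  "down \<sigma> r y = {x \<in> \<sigma>. r x \<le> r y}"

text \<open>The facets over \<open>\<sigma>\<close> are the ordered set partitions of \<open>\<sigma>\<close>, the blocks being the level sets
  of a rank function; \<open>w\<close> is paired with the union of the blocks up to its own.\<close>

definition ranked :: "'v set \<Rightarrow> ('v \<Rightarrow> nat) \<Rightarrow> ('v set \<times> 'v) set" where
  "ranked \<sigma> r = (\<lambda>y. (down \<sigma> r y, y)) ` \<sigma>"

lemma snd_ranked [simp]: "snd ` ranked \<sigma> r = \<sigma>"
  by (simp add: ranked_def image_image)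

lemma card_ranked: "card (ranked \<sigma> r) = card \<sigma>"
  unfolding ranked_def by (intro card_image) (auto simp: inj_on_def)

lemma prismatic_ranked: "finite \<sigma> \<Longrightarrow> prismatic (ranked \<sigma> r)"
  unfolding prismatic_def ranked_def down_def
  by (auto simp: psubset_eq)

text \<open>This rank induces the coarsest ordered partition compatible with \<open>Q\<close>: its blocks are the
  differences of consecutive faces of the flag of \<open>Q\<close>, and what lies outside the flag is on top.\<close>

definition coarse_rank :: "('v set \<times> 'v) set \<Rightarrow> 'v \<Rightarrow> nat" where
  "coarse_rank Q x = card {\<tau> \<in> fst ` Q. x \<notin> \<tau>}"

lemma subset_ranked_coarse_rank:
  assumes Q: "prismatic Q" and \<sigma>: "\<Union>(fst ` Q) \<subseteq> \<sigma>"
  shows "Q \<subseteq> ranked \<sigma> (coarse_rank Q)"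
proof
  fix p assume "p \<in> Q"
  obtain \<tau> w where p: "p = (\<tau>, w)" by force
  have w: "w \<in> \<tau>" using prismaticD(2)[OF Q \<open>p \<in> Q\<close>] by (simp add: p)
  have \<tau>: "\<tau> \<in> fst ` Q" "\<tau> \<subseteq> \<sigma>" using \<sigma> \<open>p \<in> Q\<close> unfolding p by force+
  have fin: "finite {\<tau> \<in> fst ` Q. x \<notin> \<tau>}" for x using prismaticD(1)[OF Q] by simp
  have above: "\<tau>' \<subset> \<tau>" if "\<tau>' \<in> fst ` Q" "x \<in> \<tau>" "x \<notin> \<tau>'" for \<tau>' x
    using prismaticD(3)[OF Q \<open>p \<in> Q\<close>] that by (auto simp: p)
  have top: "w \<notin> \<tau>'" if "\<tau>' \<in> fst ` Q" "\<tau>' \<subset> \<tau>" for \<tau>'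
    using prismaticD(4)[OF Q _ \<open>p \<in> Q\<close>] that by (auto simp: p)
  have "coarse_rank Q x \<le> coarse_rank Q w" if "x \<in> \<tau>" for x
  proof -
    have "{\<tau> \<in> fst ` Q. x \<notin> \<tau>} \<subseteq> {\<tau> \<in> fst ` Q. w \<notin> \<tau>}" using top above[OF _ that] by auto
    then show ?thesis unfolding coarse_rank_def by (rule card_mono[OF fin])
  qed
  moreover have "coarse_rank Q w < coarse_rank Q x" if "x \<notin> \<tau>" for x
    unfolding coarse_rank_def
  proof (rule psubset_card_mono[OF fin])
    have "x \<notin> \<tau>'" if "\<tau>' \<in> fst ` Q" "w \<notin> \<tau>'" for \<tau>'
      using above[OF that(1) w that(2)] \<open>x \<notin> \<tau>\<close> by auto
    then show "{\<tau> \<in> fst ` Q. w \<notin> \<tau>} \<subset> {\<tau> \<in> fst ` Q. x \<notin> \<tau>}"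
      using \<open>x \<notin> \<tau>\<close> w \<tau>(1) by auto
  qed
  ultimately have "down \<sigma> (coarse_rank Q) w = \<tau>"
    using \<tau>(2) unfolding down_def by (auto simp: not_le[symmetric])
  then show "p \<in> ranked \<sigma> (coarse_rank Q)"
    using w \<tau>(2) by (auto simp: p ranked_def)
qed

lemma ranked_insert:
  assumes "w \<notin> \<rho>" "\<And>x. x \<in> \<rho> \<Longrightarrow> r x < n"
  shows "ranked (insert w \<rho>) (r(w := n)) = insert (insert w \<rho>, w) (ranked \<rho> r)"
proof -
  have "down (insert w \<rho>) (r(w := n)) y = down \<rho> r y" if "y \<in> \<rho>" for y
    using assms(1) assms(2)[OF that] that by (auto simp: down_def)
  moreover have "down (insert w \<rho>) (r(w := n)) w = insert w \<rho>"
    using assms by (auto simp: down_def less_imp_le)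
  ultimately show ?thesis by (auto simp: ranked_def)
qed

text \<open>The \<open>d + 1\<close> second components are distinct and lie in the largest face of the flag, which has
  at most \<open>d + 1\<close> vertices. So they exhaust a facet of \<open>K\<close>, and by cardinality the facet is the
  whole of the ranked set that contains it.\<close>

lemma facets_antiprismatic_iff:
  assumes K: "simplicial_complex K" "pure d K"
  shows "P \<in> facets d (antiprismatic (of_complex K)) \<longleftrightarrow>
    (\<exists>r. snd ` P \<in> facets d K \<and> P = ranked (snd ` P) r)"
proof
  assume P: "P \<in> facets d (antiprismatic (of_complex K))"
  then have pr: "prismatic P" "P \<noteq> {}" "fst ` P \<subseteq> K" "card P = d + 1"
    by (auto simp: facets_def antiprismatic_iff[OF K(1)])
  obtain q where q: "q \<in> P" "\<Union>(fst ` P) = fst q" using prismatic_top pr by blast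
  then obtain \<sigma> where \<sigma>: "\<sigma> \<in> facets d K" "\<Union>(fst ` P) \<subseteq> \<sigma>"
    using pr(3) K(2) unfolding pure_def by (metis image_subset_iff)
  have "snd ` P \<subseteq> \<Union>(fst ` P)" using prismaticD(2)[OF pr(1)] by auto
  moreover have "card (snd ` P) = card \<sigma>"
    using pr \<sigma> by (simp add: card_image prismatic_inj_on_snd facets_def)
  ultimately have \<sigma>_eq: "snd ` P = \<sigma>"
    using \<sigma> by (meson card_subset_eq finite_facet subset_trans)
  have "P = ranked \<sigma> (coarse_rank P)"
  proof (rule card_subset_eq)
    show "finite (ranked \<sigma> (coarse_rank P))"
      using prismaticD(1)[OF prismatic_ranked[OF finite_facet[OF \<sigma>(1)]]] .
    show "P \<subseteq> ranked \<sigma> (coarse_rank P)"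
      using subset_ranked_coarse_rank pr(1) \<sigma>(2) by blast
    show "card P = card (ranked \<sigma> (coarse_rank P))"
      using pr(4) \<sigma>(1) by (simp add: card_ranked facets_def)
  qed
  then show "\<exists>r. snd ` P \<in> facets d K \<and> P = ranked (snd ` P) r"
    using \<sigma>(1) \<sigma>_eq by auto
next
  assume "\<exists>r. snd ` P \<in> facets d K \<and> P = ranked (snd ` P) r"
  then obtain \<sigma> r where \<sigma>: "\<sigma> \<in> facets d K" and P: "P = ranked \<sigma> r" by blast
  have "down \<sigma> r y \<in> K" if "y \<in> \<sigma>" for y
  proof -
    have "down \<sigma> r y \<subseteq> \<sigma>" "down \<sigma> r y \<noteq> {}" using that by (auto simp: down_def)
    then show ?thesis using \<sigma> K(1) by (auto simp: facets_def simplicial_complex_def)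
  qed
  then have "fst ` P \<subseteq> K" by (auto simp: P ranked_def)
  moreover have "card P = d + 1" using \<sigma> by (simp add: P card_ranked facets_def)
  ultimately show "P \<in> facets d (antiprismatic (of_complex K))"
    using prismatic_ranked[OF finite_facet[OF \<sigma>], of r] P
    by (auto simp: facets_def antiprismatic_iff[OF K(1)])
qed

section \<open>Connectivity of stars in the subdivision of a simplex\<close>

text \<open>A move changes the pair of a single vertex \<open>w\<close>: it passes to a neighboring facet over the same
  \<open>\<sigma>\<close>, or stays in place.\<close>

definition move :: "'v set \<Rightarrow> ('v set \<times> 'v) set \<Rightarrow> ('v set \<times> 'v) set rel" where
  "move \<sigma> Q = {(ranked \<sigma> r, ranked \<sigma> r') | r r' w.
      w \<in> \<sigma> \<and> Q \<subseteq> ranked \<sigma> r \<and> Q \<subseteq> ranked \<sigma> r' \<and> (\<forall>y\<in>\<sigma> - {w}. down \<sigma> r y = down \<sigma> r' y)}"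

lemma sym_move: "sym (move \<sigma> Q)"
  unfolding move_def by (intro symI) force

text \<open>In terms of ordered partitions, a move may split off one vertex of a block and put it below the
  rest, or merge a block with one vertex into the next block. Take the highest
  block whose vertices are not on top of their coarse block: split it if it has several vertices,
  otherwise merge it upwards. Both decrease the set of pairs of vertices that share a block and
  are not on top of their coarse block. Vertices of \<open>Q\<close> are always on top, hence not moved.\<close>

lemma moves_to_coarsest:
  assumes "finite \<sigma>" "finite Q" "Q \<subseteq> ranked \<sigma> r"
  shows "(ranked \<sigma> r, ranked \<sigma> (coarse_rank Q)) \<in> (move \<sigma> Q)\<^sup>*"
proof -
  define c where "c = coarse_rank Q"
  define low where "low r = {x \<in> \<sigma>. \<exists>y\<in>\<sigma>. c y = c x \<and> r x < r y}" for r :: "'a \<Rightarrow> nat"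
  define pairs where "pairs r = {(x, y) \<in> low r \<times> low r. r x = r y}" for r
  have fin: "finite (pairs r)" for r
  proof (rule finite_subset)
    show "pairs r \<subseteq> \<sigma> \<times> \<sigma>" by (auto simp: pairs_def low_def)
  qed (use assms in simp)
  have finQ: "finite {\<tau> \<in> fst ` Q. x \<notin> \<tau>}" for x using assms(2) by simp
  show ?thesis
    using assms(3) unfolding c_def[symmetric]
  proof (induction "card (pairs r)" arbitrary: r rule: less_induct)
    case less
    note Q = \<open>Q \<subseteq> ranked \<sigma> r\<close>
    have ideal: "y \<notin> \<tau>" if "x \<in> \<sigma>" "y \<in> \<sigma>" "r x \<le> r y" "\<tau> \<in> fst ` Q" "x \<notin> \<tau>" for x y \<tau>
      using that Q by (fastforce simp: ranked_def down_def)
    have c_mono: "c x \<le> c y" if "x \<in> \<sigma>" "y \<in> \<sigma>" "r x \<le> r y" for x y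
    proof -
      have "{\<tau> \<in> fst ` Q. x \<notin> \<tau>} \<subseteq> {\<tau> \<in> fst ` Q. y \<notin> \<tau>}" using ideal[OF that] by auto
      then show ?thesis unfolding c_def coarse_rank_def by (rule card_mono[OF finQ])
    qed
    have same: "y \<in> \<tau>" if "x \<in> \<sigma>" "y \<in> \<sigma>" "r x \<le> r y" "c x = c y" "\<tau> \<in> fst ` Q" "x \<in> \<tau>" for x y \<tau>
    proof -
      have "{\<tau> \<in> fst ` Q. x \<notin> \<tau>} = {\<tau> \<in> fst ` Q. y \<notin> \<tau>}"
      proof (rule card_subset_eq[OF finQ])
        show "{\<tau> \<in> fst ` Q. x \<notin> \<tau>} \<subseteq> {\<tau> \<in> fst ` Q. y \<notin> \<tau>}"
          using ideal[OF that(1-3)] by auto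
      qed (use that(4) in \<open>simp add: c_def coarse_rank_def\<close>)
      then show ?thesis using that(5,6) by auto
    qed
    show ?case
    proof (cases "low r = {}")
      case True
      have "r x \<le> r y \<longleftrightarrow> c x \<le> c y" if "x \<in> \<sigma>" "y \<in> \<sigma>" for x y
      proof (cases "r x \<le> r y")
        case False
        then have "c y \<le> c x" using c_mono that by simp
        moreover have "c y \<noteq> c x"
        proof
          assume "c y = c x"
          then have "y \<in> low r" using False that by (auto simp: low_def)
          then show False using True by simp
        qed
        ultimately show ?thesis using False by simp
      qed (use c_mono that in simp)
      then have "ranked \<sigma> r = ranked \<sigma> c"
        unfolding ranked_def down_def by (intro image_cong) auto
      then show ?thesis by simp
    next
      case False
      have "finite (low r)" using assms(1) by (simp add: low_def)
      then have "Max (r ` low r) \<in> r ` low r" using False by (intro Max_in) auto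
      then obtain w where "w \<in> low r" "r w = Max (r ` low r)" by force
      then have w: "w \<in> low r" "\<And>x. x \<in> low r \<Longrightarrow> r x \<le> r w"
        using \<open>finite (low r)\<close> by auto
      then have "w \<in> \<sigma>" by (simp add: low_def)
      \<comment> \<open>The next block above \<open>w\<close>, represented by \<open>t\<close>, lies in the same coarse block.\<close>
      define above where "above = {y \<in> \<sigma>. r w < r y}"
      have "finite above" "above \<noteq> {}" using assms(1) w(1) by (auto simp: above_def low_def)
      then have "Min (r ` above) \<in> r ` above" by (intro Min_in) auto
      then obtain t where "t \<in> above" "r t = Min (r ` above)" by force
      then have t: "t \<in> above" "\<And>y. y \<in> above \<Longrightarrow> r t \<le> r y"
        using \<open>finite above\<close> by auto
      obtain z where z: "z \<in> \<sigma>" "c z = c w" "r w < r z" using w(1) by (auto simp: low_def)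
      then have "c t = c w"
        using c_mono[of t z] c_mono[of w t] t(1) t(2)[of z] \<open>w \<in> \<sigma>\<close> by (simp add: above_def)
      have "w \<notin> snd ` Q"
      proof
        assume "w \<in> snd ` Q"
        then obtain \<tau> where \<tau>: "(\<tau>, w) \<in> Q" by auto
        then have "\<tau> = down \<sigma> r w" using Q by (auto simp: ranked_def)
        moreover have "z \<in> \<tau>"
          using same[of w z \<tau>] z \<tau> \<open>w \<in> \<sigma>\<close> \<open>\<tau> = down \<sigma> r w\<close> by (force simp: down_def)
        ultimately show False using z by (simp add: down_def)
      qed
      have suffices: ?thesis
        if down: "\<And>y. y \<in> \<sigma> \<Longrightarrow> y \<noteq> w \<Longrightarrow> down \<sigma> r' y = down \<sigma> r y"
          and pairs: "pairs r' \<subseteq> pairs r" "p \<in> pairs r" "p \<notin> pairs r'" for r' p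
      proof -
        have "Q \<subseteq> ranked \<sigma> r'"
        proof
          fix q assume "q \<in> Q"
          then obtain y where "q = (down \<sigma> r y, y)" "y \<in> \<sigma>" using Q by (auto simp: ranked_def)
          moreover from this have "y \<noteq> w" using \<open>w \<notin> snd ` Q\<close> \<open>q \<in> Q\<close> by force
          ultimately show "q \<in> ranked \<sigma> r'" using down by (auto simp: ranked_def)
        qed
        then have "(ranked \<sigma> r, ranked \<sigma> r') \<in> move \<sigma> Q"
          using Q down \<open>w \<in> \<sigma>\<close> unfolding move_def by fastforce
        moreover have "card (pairs r') < card (pairs r)"
          using pairs by (intro psubset_card_mono fin) blast
        ultimately show ?thesis
          using less.hyps \<open>Q \<subseteq> ranked \<sigma> r'\<close> by (meson converse_rtrancl_into_rtrancl)
      qed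
      show ?thesis
      proof (cases "\<exists>y\<in>\<sigma>. y \<noteq> w \<and> r y = r w")
        case True
        then obtain y where y: "y \<in> \<sigma>" "y \<noteq> w" "r y = r w" by blast
        \<comment> \<open>Doubling the ranks makes room for \<open>w\<close> directly below the rest of its block.\<close>
        define r' where "r' x = 2 * r x + (if x = w then 0 else 1)" for x
        show ?thesis
        proof (rule suffices)
          show "down \<sigma> r' y = down \<sigma> r y" if "y \<in> \<sigma>" "y \<noteq> w" for y
            using that by (auto simp: down_def r'_def split: if_splits)
          have low': "low r' \<subseteq> low r"
          proof
            fix x assume "x \<in> low r'"
            then obtain z where *: "x \<in> \<sigma>" "z \<in> \<sigma>" "c z = c x" "r' x < r' z" by (auto simp: low_def)
            show "x \<in> low r"
            proof (cases "x = w")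
              case False
              then have "r x < r z" using *(4) by (auto simp: r'_def split: if_splits)
              then show ?thesis using * by (auto simp: low_def)
            qed (use w in simp)
          qed
          have r'_eq: "r x = r y" if "r' x = r' y" for x y
            using that unfolding r'_def by (simp split: if_splits)
          show "pairs r' \<subseteq> pairs r" unfolding pairs_def using low' r'_eq by blast
          have "c y = c w" using c_mono[of y w] c_mono[of w y] y \<open>w \<in> \<sigma>\<close> by simp
          then have "y \<in> low r" using y z by (auto simp: low_def)
          then show "(w, y) \<in> pairs r" using w y by (simp add: pairs_def)
          show "(w, y) \<notin> pairs r'" using y by (auto simp: pairs_def r'_def)
        qed
      next
        case False
        define r' where "r' = r(w := r t)"
        show ?thesis
        proof (rule suffices)
          show "down \<sigma> r' y = down \<sigma> r y" if y: "y \<in> \<sigma>" "y \<noteq> w" for y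
          proof -
            have "r t \<le> r y \<longleftrightarrow> r w \<le> r y"
              using False y t unfolding above_def by fastforce
            then show ?thesis using y by (auto simp: down_def r'_def split: if_splits)
          qed
          have low': "x \<in> low r \<and> x \<noteq> w" if x: "x \<in> low r'" for x
          proof
            obtain z where *: "x \<in> \<sigma>" "z \<in> \<sigma>" "c z = c x" "r' x < r' z" using x by (auto simp: low_def)
            show "x \<noteq> w"
            proof
              assume "x = w"
              then have "r t < r z" "c z = c t" using * \<open>c t = c w\<close> by (auto simp: r'_def split: if_splits)
              then have "t \<in> low r" using * t(1) by (auto simp: low_def above_def)
              then show False using w(2)[of t] t(1) by (simp add: above_def)
            qed
            then have "r x < r (if z = w then t else z)" using * by (auto simp: r'_def)
            moreover have "c (if z = w then t else z) = c x" "(if z = w then t else z) \<in> \<sigma>"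
              using * \<open>c t = c w\<close> t(1) by (auto simp: above_def)
            ultimately show "x \<in> low r" using * unfolding low_def by blast
          qed
          then show "pairs r' \<subseteq> pairs r" by (auto simp: pairs_def r'_def)
          show "(w, w) \<in> pairs r" using w by (simp add: pairs_def)
          show "(w, w) \<notin> pairs r'" using low' by (auto simp: pairs_def)
        qed
      qed
    qed
  qed
qed

lemma moves_connected:
  assumes "finite \<sigma>" "Q \<subseteq> ranked \<sigma> r" "Q \<subseteq> ranked \<sigma> r'"
  shows "(ranked \<sigma> r, ranked \<sigma> r') \<in> (move \<sigma> Q)\<^sup>*"
proof -
  have "finite Q" using assms(1,2) by (auto simp: ranked_def intro: finite_subset)
  then show ?thesis
    using moves_to_coarsest[OF assms(1) _ assms(2)] moves_to_coarsest[OF assms(1) _ assms(3)]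
    by (meson rtrancl_trans sym_move sym_rtrancl symD)
qed

section \<open>Lifting colored facets to the subdivision\<close>

text \<open>The coloring of \<open>P\<close> induced by a coloring of the facet below, up to a permutation \<open>\<psi>\<close> of the
  colors. Perspectivities act on the vertices, so once \<open>\<psi>\<close> takes one base coloring to the other,
  it does so for all admissible colorings.\<close>

definition lift :: "(nat \<Rightarrow> nat) \<Rightarrow> ('v set \<times> 'v) set \<Rightarrow> ('v \<Rightarrow> nat) \<Rightarrow> ('v set \<times> 'v) colored_facet" where
  "lift \<psi> P b = (P, restrict (\<psi> \<circ> b \<circ> snd) P)"

lemma fst_lift [simp]: "fst (lift \<psi> P b) = P"
  by (simp add: lift_def)

locale subdivided_complex =
  fixes d :: nat and K :: "'v set set" and \<psi> :: "nat \<Rightarrow> nat"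
  assumes complex: "simplicial_complex K" and pure: "pure d K"
    and \<psi>: "bij_betw \<psi> {0..d} {0..d}"
begin

abbreviation "aK \<equiv> antiprismatic (of_complex K)"

lemmas facets_aK_iff = facets_antiprismatic_iff[OF complex pure]

lemma facets_aK:
  assumes "P \<in> facets d aK"
  shows "snd ` P \<in> facets d K" "prismatic P" "\<And>p. p \<in> P \<Longrightarrow> fst p \<subseteq> snd ` P"
proof -
  obtain r where r: "snd ` P \<in> facets d K" "P = ranked (snd ` P) r"
    using assms facets_aK_iff by blast
  then show "snd ` P \<in> facets d K" "prismatic P"
    using prismatic_ranked[OF finite_facet[OF r(1)], of r] by simp_all
  show "fst p \<subseteq> snd ` P" if "p \<in> P" for p
  proof -
    have "p \<in> ranked (snd ` P) r" using that r(2) by simp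
    then have "\<exists>y. p = (down (snd ` P) r y, y)" unfolding ranked_def by blast
    then show ?thesis by (auto simp: down_def)
  qed
qed

lemma facets_aK_bij: "P \<in> facets d aK \<Longrightarrow> bij_betw snd P (snd ` P)"
  using prismatic_inj_on_snd[OF facets_aK(2)] by (rule inj_on_imp_bij_betw)

lemma coloring_lift:
  assumes "P \<in> facets d aK" "coloring d (snd ` P) b"
  shows "coloring d P (snd (lift \<psi> P b))"
proof -
  have "bij_betw (\<psi> \<circ> (b \<circ> snd)) P {0..d}"
    using assms facets_aK_bij \<psi> unfolding coloring_def by (metis bij_betw_trans)
  then show ?thesis
    unfolding lift_def snd_conv by (intro coloring_restrict) (simp add: comp_assoc)
qed

lemma lift_agree_iff:
  assumes "coloring d (snd ` P) b" "coloring d (snd ` P') b'" "p \<in> P" "p \<in> P'"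
  shows "snd (lift \<psi> P b) p = snd (lift \<psi> P' b') p \<longleftrightarrow> b (snd p) = b' (snd p)"
proof -
  have "b (snd p) \<in> {0..d}" "b' (snd p) \<in> {0..d}"
    using assms unfolding coloring_def bij_betw_def by blast+
  then show ?thesis
    using \<psi> assms(3,4) by (auto simp: lift_def bij_betw_def dest: inj_onD)
qed

lemma lift_surj:
  assumes P: "P \<in> facets d aK" and \<beta>: "coloring d P \<beta>"
  obtains b where "coloring d (snd ` P) b" "lift \<psi> P b = (P, \<beta>)"
proof
  define b where "b = restrict (inv_into {0..d} \<psi> \<circ> (\<beta> \<circ> inv_into P snd)) (snd ` P)"
  have "bij_betw (inv_into {0..d} \<psi> \<circ> (\<beta> \<circ> inv_into P snd)) (snd ` P) {0..d}"
    using bij_betw_inv_into[OF facets_aK_bij[OF P]] bij_betw_inv_into[OF \<psi>] \<beta>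
    unfolding coloring_def by (metis bij_betw_trans)
  then show "coloring d (snd ` P) b" unfolding b_def by (rule coloring_restrict)
  have "\<psi> (b (snd p)) = \<beta> p" if "p \<in> P" for p
  proof -
    have "inv_into P snd (snd p) = p"
      using facets_aK_bij[OF P] that by (simp add: bij_betw_def)
    moreover have "\<beta> p \<in> \<psi> ` {0..d}"
      using \<beta> \<psi> that unfolding coloring_def bij_betw_def by blast
    ultimately show ?thesis using that by (simp add: b_def f_inv_into_f)
  qed
  then show "lift \<psi> P b = (P, \<beta>)"
    using \<beta> by (auto simp: lift_def coloring_def extensional_def restrict_def)
qed

lemma lift_inj:
  assumes "coloring d (snd ` P) b" "coloring d (snd ` P) b'" "lift \<psi> P b = lift \<psi> P b'"
  shows "b = b'"
proof
  fix v
  have "b v = b' v" if "v \<in> snd ` P"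
    using lift_agree_iff[OF assms(1,2)] assms(3) that by auto
  then show "b v = b' v"
    using assms(1,2) by (cases "v \<in> snd ` P") (auto simp: coloring_def extensional_def)
qed

text \<open>Two neighboring facets of \<open>a(K)\<close> have \<open>d\<close> vertices in common, which lie over \<open>d\<close> vertices
  common to the facets of \<open>K\<close> below. So those are equal, with the same coloring, or neighbors.\<close>

lemma glue_lift_down:
  assumes P: "P \<in> facets d aK" "P' \<in> facets d aK"
    and b: "coloring d (snd ` P) b" "coloring d (snd ` P') b'"
    and glue: "(lift \<psi> P b, lift \<psi> P' b') \<in> glue d aK Q"
  shows "((snd ` P, b), (snd ` P', b')) \<in> (glue d K (\<Union>(fst ` Q)))\<^sup>="
proof -
  define S where "S = snd ` (P \<inter> P')"
  have nb: "card (P \<inter> P') = d" and Q: "Q \<subseteq> P \<inter> P'"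
    and agree: "\<And>p. p \<in> P \<inter> P' \<Longrightarrow> snd (lift \<psi> P b) p = snd (lift \<psi> P' b') p"
    using glue unfolding in_glue_iff fst_lift neighbors_def by blast+
  have "card S = d"
    using nb inj_on_subset[OF prismatic_inj_on_snd[OF facets_aK(2)[OF P(1)]]]
    by (simp add: S_def card_image)
  have S: "S \<subseteq> snd ` P \<inter> snd ` P'" by (auto simp: S_def)
  have eq: "b v = b' v" if "v \<in> S" for v
    using that agree lift_agree_iff[OF b] by (auto simp: S_def)
  have facets: "snd ` P \<in> facets d K" "snd ` P' \<in> facets d K" using P facets_aK by auto
  then have card: "card (snd ` P) = d + 1" "card (snd ` P') = d + 1" by (simp_all add: facets_def)
  have fin: "finite (snd ` P)" "finite (snd ` P')" using facets finite_facet by auto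
  show ?thesis
  proof (cases "snd ` P = snd ` P'")
    case True
    then have "b = b'"
      using coloring_eq_if_agree_off_one[of d "snd ` P" b b' S] b card S \<open>card S = d\<close> eq by simp
    then show ?thesis using True by simp
  next
    case False
    have "snd ` P \<inter> snd ` P' \<noteq> snd ` P"
      using False card card_subset_eq[OF fin(2), of "snd ` P"] by (metis inf_le2)
    then have "card (snd ` P \<inter> snd ` P') < d + 1"
      using psubset_card_mono[OF fin(1), of "snd ` P \<inter> snd ` P'"] card by auto
    moreover have "d \<le> card (snd ` P \<inter> snd ` P')"
      using card_mono[OF _ S] fin \<open>card S = d\<close> by simp
    ultimately have int: "card (snd ` P \<inter> snd ` P') = d" by simp
    then have "S = snd ` P \<inter> snd ` P'"
      using card_subset_eq[OF _ S] fin \<open>card S = d\<close> by simp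
    moreover have "\<Union>(fst ` Q) \<subseteq> snd ` P \<inter> snd ` P'"
      using Q facets_aK(3)[OF P(1)] facets_aK(3)[OF P(2)] by blast
    ultimately have "((snd ` P, b), (snd ` P', b')) \<in> glue d K (\<Union>(fst ` Q))"
      using False facets int b eq unfolding glue_def neighbors_def by auto
    then show ?thesis by simp
  qed
qed

text \<open>Complete \<open>Q\<close> to a facet of the subdivision of the ridge \<open>\<sigma> \<inter> \<sigma>'\<close>, and put the missing vertex
  of \<open>\<sigma>\<close>, or of \<open>\<sigma>'\<close>, on top.\<close>

lemma glue_lift_up:
  assumes glue: "((\<sigma>, b), (\<sigma>', b')) \<in> glue d K (\<Union>(fst ` Q))" and Q: "prismatic Q"
  obtains P P' where "P \<in> facets d aK" "snd ` P = \<sigma>" "Q \<subseteq> P"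
    "P' \<in> facets d aK" "snd ` P' = \<sigma>'" "Q \<subseteq> P'" "(lift \<psi> P b, lift \<psi> P' b') \<in> glue d aK Q"
proof -
  define \<rho> where "\<rho> = \<sigma> \<inter> \<sigma>'"
  have nb: "neighbors d K \<sigma> \<sigma>'" and b: "coloring d \<sigma> b" "coloring d \<sigma>' b'"
    and agree: "\<And>v. v \<in> \<rho> \<Longrightarrow> b v = b' v" and Q\<rho>: "\<Union>(fst ` Q) \<subseteq> \<rho>"
    using glue unfolding in_glue_iff fst_conv snd_conv \<rho>_def by blast+
  have facets: "\<sigma> \<in> facets d K" "\<sigma>' \<in> facets d K" and card: "card \<rho> = d"
    using nb by (auto simp: neighbors_def \<rho>_def)
  have fin: "finite \<sigma>" "finite \<sigma>'" using facets finite_facet by auto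
  have "card (\<sigma> - \<sigma>') = 1" "card (\<sigma>' - \<sigma>) = 1"
    using card fin facets
    by (simp_all add: card_Diff_subset_Int facets_def \<rho>_def Int_commute)
  then obtain v v' where vv': "\<sigma> - \<sigma>' = {v}" "\<sigma>' - \<sigma> = {v'}" by (auto simp: card_1_singleton_iff)
  then have v: "insert v \<rho> = \<sigma>" "v \<notin> \<rho>" "insert v' \<rho> = \<sigma>'" "v' \<notin> \<rho>" "v \<noteq> v'"
    unfolding \<rho>_def by blast+
  define r where "r = coarse_rank Q"
  define n where "n = Suc (Max (r ` \<rho>))"
  have r: "r x < n" if "x \<in> \<rho>" for x
    unfolding n_def using that fin by (simp add: \<rho>_def less_Suc_eq_le)
  define R where "R = ranked \<rho> r"
  have R: "Q \<subseteq> R" "snd ` R = \<rho>" "card R = d" "finite R"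
    unfolding R_def r_def using subset_ranked_coarse_rank[OF Q Q\<rho>] card fin
      prismaticD(1)[OF prismatic_ranked[of \<rho>]] by (auto simp: card_ranked \<rho>_def)
  define P where "P = insert (\<sigma>, v) R"
  define P' where "P' = insert (\<sigma>', v') R"
  have snd: "snd ` P = \<sigma>" "snd ` P' = \<sigma>'" using R(2) v by (auto simp: P_def P'_def)
  have "P = ranked \<sigma> (r(v := n))" "P' = ranked \<sigma>' (r(v' := n))"
    using ranked_insert[of v \<rho> r n] ranked_insert[of v' \<rho> r n] r v
    by (simp_all add: P_def P'_def R_def)
  then have P: "P \<in> facets d aK" "P' \<in> facets d aK"
    unfolding facets_aK_iff snd using facets by blast+
  have "(\<sigma>, v) \<notin> R" "(\<sigma>', v') \<notin> R" using R(2) v by force+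
  then have int: "P \<inter> P' = R" and "P \<noteq> P'" using v(5) by (auto simp: P_def P'_def)
  have "snd (lift \<psi> P b) p = snd (lift \<psi> P' b') p" if "p \<in> R" for p
  proof -
    have "snd p \<in> \<rho>" using that R(2) by blast
    then show ?thesis using lift_agree_iff[of P b P' b' p] that int b snd agree by blast
  qed
  then have "(lift \<psi> P b, lift \<psi> P' b') \<in> glue d aK Q"
    using P \<open>P \<noteq> P'\<close> int R coloring_lift[of P b] coloring_lift[of P' b'] b snd
    unfolding in_glue_iff fst_lift neighbors_def by auto
  then show ?thesis using that P snd R(1) unfolding P_def P'_def by blast
qed

lemma move_lift:
  assumes move: "(P, P') \<in> move \<sigma> Q" and \<sigma>: "\<sigma> \<in> facets d K" and b: "coloring d \<sigma> b"
  shows "(lift \<psi> P b, lift \<psi> P' b) \<in> (glue d aK Q)\<^sup>="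
proof (cases "P = P'")
  case False
  obtain r r' w where P: "P = ranked \<sigma> r" "P' = ranked \<sigma> r'" and w: "w \<in> \<sigma>"
    and Q: "Q \<subseteq> P" "Q \<subseteq> P'" and down: "\<And>y. y \<in> \<sigma> - {w} \<Longrightarrow> down \<sigma> r y = down \<sigma> r' y"
    using move unfolding move_def by blast
  have snd: "snd ` P = \<sigma>" "snd ` P' = \<sigma>" using P by auto
  have fin: "finite \<sigma>" "card \<sigma> = d + 1" using \<sigma> finite_facet by (auto simp: facets_def)
  then have card: "card P = d + 1" "card P' = d + 1" "finite P" "finite P'"
    using prismaticD(1)[OF prismatic_ranked[OF fin(1)]] by (simp_all add: P card_ranked)
  have facets: "P \<in> facets d aK" "P' \<in> facets d aK"
    unfolding facets_aK_iff snd using \<sigma> P by blast+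
  define R where "R = (\<lambda>y. (down \<sigma> r y, y)) ` (\<sigma> - {w})"
  have "R \<subseteq> P \<inter> P'"
  proof
    fix p assume "p \<in> R"
    then obtain y where "y \<in> \<sigma> - {w}" "p = (down \<sigma> r y, y)" by (auto simp: R_def)
    then show "p \<in> P \<inter> P'" using down[of y] by (auto simp: P ranked_def)
  qed
  moreover have "card R = d"
    unfolding R_def using fin w by (subst card_image) (auto simp: inj_on_def)
  ultimately have "d \<le> card (P \<inter> P')" using card_mono[of "P \<inter> P'" R] card by simp
  moreover have "P \<inter> P' \<noteq> P" using False card card_subset_eq[of P' P] by auto
  then have "card (P \<inter> P') < d + 1"
    using psubset_card_mono[of P "P \<inter> P'"] card by auto
  ultimately have "card (P \<inter> P') = d" by simp
  then have "neighbors d aK P P'" using facets False by (simp add: neighbors_def)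
  then have "(lift \<psi> P b, lift \<psi> P' b) \<in> glue d aK Q"
    using Q coloring_lift[OF facets(1)] coloring_lift[OF facets(2)] b snd
    unfolding in_glue_iff fst_lift by (auto simp: lift_def)
  then show ?thesis by simp
qed simp

lemma star_connected:
  assumes P: "P \<in> facets d aK" "P' \<in> facets d aK" "snd ` P = snd ` P'" "Q \<subseteq> P" "Q \<subseteq> P'"
    and b: "coloring d (snd ` P) b"
  shows "(lift \<psi> P b, lift \<psi> P' b) \<in> (glue d aK Q)\<^sup>*"
proof -
  have \<sigma>: "snd ` P \<in> facets d K" using facets_aK P(1) by blast
  obtain r r' where "P = ranked (snd ` P) r" "P' = ranked (snd ` P) r'"
    using P(1,2) unfolding facets_aK_iff P(3) by metis
  then have "(P, P') \<in> (move (snd ` P) Q)\<^sup>*"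
    using moves_connected[OF finite_facet[OF \<sigma>]] P(4,5) by metis
  then show ?thesis
  proof (induction rule: rtrancl_induct)
    case (step P' P'')
    then show ?case
      using move_lift[OF step(2) \<sigma> b] by (auto intro: rtrancl.rtrancl_into_rtrancl)
  qed simp
qed

lemma reachable_lift_down:
  assumes "(lift \<psi> P b, j) \<in> (glue d aK Q)\<^sup>*" "P \<in> facets d aK" "coloring d (snd ` P) b"
  shows "\<exists>P' b'. j = lift \<psi> P' b' \<and> P' \<in> facets d aK \<and> coloring d (snd ` P') b' \<and>
    ((snd ` P, b), (snd ` P', b')) \<in> (glue d K (\<Union>(fst ` Q)))\<^sup>*"
  using assms(1)
proof (induction rule: rtrancl_induct)
  case base
  then show ?case using assms(2,3) by blast
next
  case (step j k)
  then obtain P' b' where j: "j = lift \<psi> P' b'" "P' \<in> facets d aK" "coloring d (snd ` P') b'"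
    and reach: "((snd ` P, b), (snd ` P', b')) \<in> (glue d K (\<Union>(fst ` Q)))\<^sup>*" by blast
  obtain P'' \<beta> where k: "k = (P'', \<beta>)" by force
  have P'': "P'' \<in> facets d aK" "coloring d P'' \<beta>"
    using step(2) unfolding k by (auto simp: glue_def neighbors_def)
  then obtain b'' where b'': "coloring d (snd ` P'') b''" "lift \<psi> P'' b'' = (P'', \<beta>)"
    using lift_surj by blast
  have "((snd ` P', b'), (snd ` P'', b'')) \<in> (glue d K (\<Union>(fst ` Q)))\<^sup>="
    using glue_lift_down[OF j(2) P''(1) j(3) b''(1)] step(2) j(1) k b''(2) by simp
  then have "((snd ` P, b), (snd ` P'', b'')) \<in> (glue d K (\<Union>(fst ` Q)))\<^sup>*"
    using reach by (auto intro: rtrancl.rtrancl_into_rtrancl)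
  then show ?case using k b'' P''(1) by metis
qed

lemma reachable_lift_up:
  assumes "((\<sigma>, b), j) \<in> (glue d K (\<Union>(fst ` Q)))\<^sup>*" "coloring d \<sigma> b"
    and P: "P \<in> facets d aK" "snd ` P = \<sigma>" "Q \<subseteq> P"
    and P': "P' \<in> facets d aK" "snd ` P' = fst j" "Q \<subseteq> P'"
  shows "(lift \<psi> P b, lift \<psi> P' (snd j)) \<in> (glue d aK Q)\<^sup>*"
  using assms(1) P'
proof (induction arbitrary: P' rule: rtrancl_induct)
  case base
  then show ?case using star_connected[of P P' Q b] P assms(2) by simp
next
  case (step j k)
  obtain \<sigma>' b' \<sigma>'' b'' where jk: "j = (\<sigma>', b')" "k = (\<sigma>'', b'')" by force
  have "prismatic Q" using prismatic_subset[OF facets_aK(2)[OF P(1)] P(3)] .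
  have glue: "((\<sigma>', b'), (\<sigma>'', b'')) \<in> glue d K (\<Union>(fst ` Q))" using step(2) jk by simp
  obtain R R' where R: "R \<in> facets d aK" "snd ` R = \<sigma>'" "Q \<subseteq> R"
    "R' \<in> facets d aK" "snd ` R' = \<sigma>''" "Q \<subseteq> R'" "(lift \<psi> R b', lift \<psi> R' b'') \<in> glue d aK Q"
    by (rule glue_lift_up[OF glue \<open>prismatic Q\<close>])
  have "coloring d \<sigma>'' b''" using glue by (simp add: in_glue_iff)
  have "(lift \<psi> P b, lift \<psi> R b') \<in> (glue d aK Q)\<^sup>*"
    using step.IH[of R] R jk by simp
  then have "(lift \<psi> P b, lift \<psi> R' b'') \<in> (glue d aK Q)\<^sup>*"
    using R(7) by (rule rtrancl.rtrancl_into_rtrancl)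
  also have "(lift \<psi> R' b'', lift \<psi> P' b'') \<in> (glue d aK Q)\<^sup>*"
    using star_connected[of R' P' Q b''] R step.prems jk \<open>coloring d \<sigma>'' b''\<close> by simp
  finally show ?case by (simp add: jk)
qed

text \<open>For \<open>Q = {}\<close> this compares admissible colorings, for \<open>Q\<close> a single pair \<open>(\<tau>, w)\<close> it compares
  vertices of the unfolding of \<open>a(K)\<close> with copies of the face \<open>\<tau>\<close> of \<open>K\<close>.\<close>

lemma reachable_lift_iff:
  assumes P: "P \<in> facets d aK" "P' \<in> facets d aK" "Q \<subseteq> P" "Q \<subseteq> P'"
    and b: "coloring d (snd ` P) b" "coloring d (snd ` P') b'"
  shows "(lift \<psi> P b, lift \<psi> P' b') \<in> (glue d aK Q)\<^sup>* \<longleftrightarrow>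
    ((snd ` P, b), (snd ` P', b')) \<in> (glue d K (\<Union>(fst ` Q)))\<^sup>*"
proof
  assume "(lift \<psi> P b, lift \<psi> P' b') \<in> (glue d aK Q)\<^sup>*"
  then obtain R c where R: "lift \<psi> P' b' = lift \<psi> R c" "coloring d (snd ` R) c"
    "((snd ` P, b), (snd ` R, c)) \<in> (glue d K (\<Union>(fst ` Q)))\<^sup>*"
    using reachable_lift_down P(1) b(1) by blast
  have "R = P'" using R(1) by (simp add: lift_def)
  then show "((snd ` P, b), (snd ` P', b')) \<in> (glue d K (\<Union>(fst ` Q)))\<^sup>*"
    using R lift_inj[OF b(2), of c] by simp
next
  assume "((snd ` P, b), (snd ` P', b')) \<in> (glue d K (\<Union>(fst ` Q)))\<^sup>*"
  then show "(lift \<psi> P b, lift \<psi> P' b') \<in> (glue d aK Q)\<^sup>*"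
    using reachable_lift_up[of "snd ` P" b "(snd ` P', b')" Q P P'] P b by simp
qed

end

section \<open>The isomorphism\<close>

text \<open>Simplices of \<open>J\<close> are determined by their vertices because their images are.\<close>

lemma is_simplicial_if_iso_to_complex:
  assumes iso: "pseudo_iso J (of_complex L) f \<phi>" and L: "simplicial_complex L"
  shows "is_simplicial J"
proof -
  note iso' = iso[unfolded pseudo_iso_def of_complex_def pseudo_complex.select_convs]
  have f: "inj_on f (vertices J)" using iso' by (elim conjE, simp add: bij_betw_def)
  have \<phi>: "bij_betw \<phi> (simplices J) L" using iso' by (elim conjE)
  have \<phi>_eq: "\<forall>s\<in>simplices J. \<phi> s = f ` verts J s" using iso' by (elim conjE)
  have le: "\<forall>s\<in>simplices J. \<forall>t\<in>simplices J. \<phi> s \<subseteq> \<phi> t \<longleftrightarrow> face_le J s t"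
    using iso' by (elim conjE)
  have sub: "verts J s \<subseteq> vertices J" if "s \<in> simplices J" for s
    using that by (auto simp: vertices_def)
  have \<phi>_subset: "\<phi> s \<subseteq> \<phi> t \<longleftrightarrow> verts J s \<subseteq> verts J t"
    if "s \<in> simplices J" "t \<in> simplices J" for s t
  proof
    assume "\<phi> s \<subseteq> \<phi> t"
    then have "f x \<in> f ` verts J t" if "x \<in> verts J s" for x
      using that \<phi>_eq \<open>s \<in> simplices J\<close> \<open>t \<in> simplices J\<close> by auto
    then show "verts J s \<subseteq> verts J t"
      using inj_on_image_mem_iff[OF f _ sub[OF that(2)]] sub[OF that(1)] by blast
  next
    assume "verts J s \<subseteq> verts J t"
    then show "\<phi> s \<subseteq> \<phi> t" using that \<phi>_eq by (simp add: image_mono)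
  qed
  have "inj_on (verts J) (simplices J)"
  proof (rule inj_onI)
    fix s t assume "s \<in> simplices J" "t \<in> simplices J" "verts J s = verts J t"
    then show "s = t" using \<phi>_eq \<phi> by (metis bij_betw_imp_inj_on inj_onD)
  qed
  moreover have "simplicial_complex (verts J ` simplices J)"
    unfolding simplicial_complex_def
  proof (intro ballI conjI allI impI; elim imageE conjE)
    fix \<sigma> s assume s: "\<sigma> = verts J s" "s \<in> simplices J"
    then have \<phi>s: "\<phi> s \<in> L" "\<phi> s = f ` \<sigma>" using \<phi> \<phi>_eq by (auto simp: bij_betw_def)
    have "inj_on f \<sigma>" using f sub[OF s(2)] s(1) inj_on_subset by blast
    have "finite (f ` \<sigma>)" "f ` \<sigma> \<noteq> {}"
      using \<phi>s L unfolding simplicial_complex_def by auto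
    then show "finite \<sigma>" "\<sigma> \<noteq> {}"
      using finite_imageD[OF _ \<open>inj_on f \<sigma>\<close>] by auto
    fix \<tau> assume \<tau>: "\<tau> \<subseteq> \<sigma>" "\<tau> \<noteq> {}"
    then have "f ` \<tau> \<subseteq> \<phi> s" "f ` \<tau> \<noteq> {}" using \<phi>s(2) by auto
    then have "f ` \<tau> \<in> \<phi> ` simplices J"
      using L \<phi>s(1) unfolding simplicial_complex_def bij_betw_imp_surj_on[OF \<phi>] by blast
    then obtain t where t: "t \<in> simplices J" "f ` \<tau> = f ` verts J t" using \<phi>_eq by auto
    have "\<tau> \<subseteq> vertices J" using \<tau>(1) sub[OF s(2)] s(1) by blast
    then have "\<tau> = verts J t"
      using inj_on_image_eq_iff[OF f _ sub[OF t(1)]] t(2) by simp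
    then show "\<tau> \<in> verts J ` simplices J" using t(1) by blast
  qed
  moreover have "\<forall>s\<in>simplices J. \<forall>t\<in>simplices J. verts J s \<subseteq> verts J t \<longleftrightarrow> face_le J s t"
    using le \<phi>_subset by blast
  ultimately show ?thesis
    unfolding is_simplicial_def pseudo_iso_def of_complex_def vertices_def bij_betw_def by simp
qed

lemma antiprismaticE:
  assumes "F \<in> antiprismatic J"
  obtains S x and k :: nat where "F = {(S i, x i) | i. i \<le> k}"
    "\<And>i. i \<le> k \<Longrightarrow> S i \<in> simplices J \<and> x i \<in> verts J (S i)"
    "\<And>i j. i \<le> j \<Longrightarrow> j \<le> k \<Longrightarrow> face_le J (S i) (S j)"
    "\<And>i j. i \<le> k \<Longrightarrow> j \<le> k \<Longrightarrow> face_le J (S i) (S j) \<Longrightarrow> S i \<noteq> S j \<Longrightarrow> x j \<notin> verts J (S i)"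
  using assms unfolding antiprismatic_def mem_Collect_eq
proof (elim exE conjE)
  fix k :: nat and S x
  assume 1: "F = {(S i, x i) | i. i \<le> k}"
    and 2: "\<forall>i\<le>k. S i \<in> simplices J \<and> x i \<in> verts J (S i)"
    and 3: "\<forall>i j. i \<le> j \<and> j \<le> k \<longrightarrow> face_le J (S i) (S j)"
    and 4: "\<forall>i\<le>k. \<forall>j\<le>k. face_le J (S i) (S j) \<and> S i \<noteq> S j \<longrightarrow> x j \<notin> verts J (S i)"
  show thesis by (rule that[OF 1]) (use 2 3 4 in simp_all)
qed

locale subdivided_unfolding =
  K: based_unfolding d K \<sigma>\<^sub>0 b\<^sub>0 + subdivided_complex d K \<psi> +
  A: based_unfolding d "antiprismatic (of_complex K)" \<sigma>\<^sub>1 b\<^sub>1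
  for d :: nat and K :: "'v set set" and \<sigma>\<^sub>0 b\<^sub>0 \<psi> \<sigma>\<^sub>1 b\<^sub>1 +
  assumes base: "\<exists>b. (snd ` \<sigma>\<^sub>1, b) \<in> colored_facets d K \<sigma>\<^sub>0 b\<^sub>0 \<and> lift \<psi> \<sigma>\<^sub>1 b = (\<sigma>\<^sub>1, restrict b\<^sub>1 \<sigma>\<^sub>1)"
begin

definition lifted :: "('v set \<times> 'v) set \<Rightarrow> ('v \<Rightarrow> nat) \<Rightarrow> bool" where
  "lifted P b \<longleftrightarrow> P \<in> facets d aK \<and> (snd ` P, b) \<in> K.C"

lemma lifted_coloring: "lifted P b \<Longrightarrow> coloring d (snd ` P) b"
  using K.C_coloring by (fastforce simp: lifted_def)

lemma lifted_reachable_iff: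
  assumes "lifted P b" "lifted P' b'" "Q \<subseteq> P" "Q \<subseteq> P'"
  shows "(lift \<psi> P b, lift \<psi> P' b') \<in> (glue d aK Q)\<^sup>* \<longleftrightarrow>
    ((snd ` P, b), (snd ` P', b')) \<in> (glue d K (\<Union>(fst ` Q)))\<^sup>*"
  using assms lifted_coloring by (intro reachable_lift_iff) (auto simp: lifted_def)

lemma lifted_prismatic:
  assumes "lifted P b" "Q \<subseteq> P"
  shows "prismatic Q"
  using assms facets_aK(2) prismatic_subset by (auto simp: lifted_def)

lemma colored_facets_aK: "A.C = {lift \<psi> P b | P b. lifted P b}"
proof -
  obtain b where b: "(snd ` \<sigma>\<^sub>1, b) \<in> K.C" and lift: "lift \<psi> \<sigma>\<^sub>1 b = (\<sigma>\<^sub>1, restrict b\<^sub>1 \<sigma>\<^sub>1)"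
    using base by blast
  have base_lifted: "lifted \<sigma>\<^sub>1 b" using b A.base_facet by (simp add: lifted_def)
  show ?thesis
  proof (intro equalityI subsetI)
    fix j assume "j \<in> A.C"
    then have "(lift \<psi> \<sigma>\<^sub>1 b, j) \<in> (glue d aK {})\<^sup>*" by (simp add: A.C_eq lift)
    then obtain P' b' where j: "j = lift \<psi> P' b'" "P' \<in> facets d aK"
      and reach: "((snd ` \<sigma>\<^sub>1, b), (snd ` P', b')) \<in> (glue d K {})\<^sup>*"
      using reachable_lift_down[of \<sigma>\<^sub>1 b j "{}"] A.base_facet lifted_coloring[OF base_lifted]
      unfolding image_empty Union_empty by blast
    have "lifted P' b'" using K.C_glue_closed[OF b reach] j(2) by (simp add: lifted_def)
    then show "j \<in> {lift \<psi> P b | P b. lifted P b}" using j(1) by blast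
  next
    fix j assume "j \<in> {lift \<psi> P b | P b. lifted P b}"
    then obtain P' b' where j: "j = lift \<psi> P' b'" "lifted P' b'" by blast
    have "((snd ` \<sigma>\<^sub>1, b), (snd ` P', b')) \<in> (glue d K {})\<^sup>*"
      using b j(2) unfolding lifted_def K.C_eq
      by (metis Image_singleton_iff glue_sym rtrancl_trans)
    then have "(lift \<psi> \<sigma>\<^sub>1 b, j) \<in> (glue d aK {})\<^sup>*"
      using lifted_reachable_iff[OF base_lifted j(2), of "{}"] j(1) by simp
    then show "j \<in> A.C" by (simp add: A.C_eq lift)
  qed
qed

lemma simplices_uaK:
  "simplices A.U = {face_class d aK (lift \<psi> P b) Q | P b Q. lifted P b \<and> Q \<subseteq> P \<and> Q \<noteq> {}}"
proof -
  have "simplices A.U = {face_class d aK i Q | i Q. (\<exists>P b. i = lift \<psi> P b \<and> lifted P b) \<and> Q \<subseteq> fst i \<and> Q \<noteq> {}}"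
    unfolding A.simplices_unfolding colored_facets_aK by simp
  also have "\<dots> = {face_class d aK (lift \<psi> P b) Q | P b Q. lifted P b \<and> Q \<subseteq> P \<and> Q \<noteq> {}}"
    by (intro Collect_cong) (metis fst_lift)
  finally show ?thesis .
qed

lemma verts_uaK:
  "lifted P b \<Longrightarrow> verts A.U (face_class d aK (lift \<psi> P b) Q) = vertex_class d aK (lift \<psi> P b) ` Q"
  by (intro A.verts_unfolding) (auto simp: colored_facets_aK)

text \<open>The isomorphism on vertices, in terms of representatives.\<close>

definition image_vertex ::
    "('v set \<times> 'v) set \<Rightarrow> ('v \<Rightarrow> nat) \<Rightarrow> 'v set \<times> 'v \<Rightarrow>
      ('v colored_facet \<times> 'v set) set \<times> ('v colored_facet \<times> 'v) set" where
  "image_vertex P b p =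
    (face_class d K (snd ` P, b) (fst p), vertex_class d K (snd ` P, b) (snd p))"

lemma unfold_image_vertex:
  "antiprismatic_map unfold_vertex unfold_simplex (image_vertex P b p) = p"
  by (simp add: antiprismatic_map_def image_vertex_def unfold_simplex_face_class unfold_vertex_vertex_class)

lemma image_vertex_eq_iff:
  assumes "snd p \<in> fst p"
  shows "image_vertex P b p = image_vertex P' b' p' \<longleftrightarrow>
    p = p' \<and> ((snd ` P, b), (snd ` P', b')) \<in> (glue d K (fst p))\<^sup>*"
  using assms glue_antimono[of "{snd p}" "fst p" "(snd ` P, b)" "(snd ` P', b')" d K]
  by (auto simp: image_vertex_def face_class_eq_iff vertex_class_eq_iff prod_eq_iff)

lemma image_vertex_eq_iff_class_eq:
  assumes "lifted P b" "lifted P' b'" "p \<in> P" "p' \<in> P'"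
  shows "image_vertex P b p = image_vertex P' b' p' \<longleftrightarrow>
    vertex_class d aK (lift \<psi> P b) p = vertex_class d aK (lift \<psi> P' b') p'"
proof -
  have "snd p \<in> fst p" using prismaticD(2)[OF lifted_prismatic[OF assms(1) subset_refl] assms(3)] .
  then show ?thesis
    using lifted_reachable_iff[OF assms(1,2), of "{p}"] assms(3,4)
    by (auto simp: image_vertex_eq_iff vertex_class_eq_iff)
qed

text \<open>Inclusion of the images amounts to inclusion of \<open>Q\<close> in \<open>Q'\<close> and to the copies of the top face of
  the flag of \<open>Q\<close> being identified, since every smaller face of the flag follows.\<close>

lemma image_vertex_subset_iff:
  assumes PP: "lifted P b" "lifted P' b'" and Q: "Q \<subseteq> P" "Q' \<subseteq> P'" "Q \<noteq> {}"
  shows "image_vertex P b ` Q \<subseteq> image_vertex P' b' ` Q' \<longleftrightarrow>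
    face_le A.U (face_class d aK (lift \<psi> P b) Q) (face_class d aK (lift \<psi> P' b') Q')"
proof -
  let ?r = "\<lambda>T. ((snd ` P, b), (snd ` P', b')) \<in> (glue d K T)\<^sup>*"
  have pr: "prismatic Q" by (rule lifted_prismatic[OF PP(1) Q(1)])
  obtain q where q: "q \<in> Q" "\<Union>(fst ` Q) = fst q" by (rule prismatic_top[OF pr Q(3)])
  have eq: "image_vertex P b p = image_vertex P' b' p' \<longleftrightarrow> p = p' \<and> ?r (fst p)" if "p \<in> Q" for p p'
    by (rule image_vertex_eq_iff[OF prismaticD(2)[OF pr that]])
  have "image_vertex P b ` Q \<subseteq> image_vertex P' b' ` Q' \<longleftrightarrow> Q \<subseteq> Q' \<and> ?r (\<Union>(fst ` Q))"
  proof
    assume sub: "image_vertex P b ` Q \<subseteq> image_vertex P' b' ` Q'"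
    have *: "p \<in> Q' \<and> ?r (fst p)" if "p \<in> Q" for p
    proof -
      have "image_vertex P b p \<in> image_vertex P' b' ` Q'" using sub imageI[OF that] by (rule subsetD)
      then obtain p' where "p' \<in> Q'" "image_vertex P b p = image_vertex P' b' p'" by (rule imageE)
      then show ?thesis using eq[OF that, of p'] by auto
    qed
    then show "Q \<subseteq> Q' \<and> ?r (\<Union>(fst ` Q))" using q by auto
  next
    assume *: "Q \<subseteq> Q' \<and> ?r (\<Union>(fst ` Q))"
    have "image_vertex P b p = image_vertex P' b' p" if "p \<in> Q" for p
    proof -
      have "fst p \<subseteq> \<Union>(fst ` Q)" using that by blast
      then have "?r (fst p)" using * by (intro glue_antimono[of "fst p" "\<Union>(fst ` Q)"]) simp_all
      then show ?thesis using eq[OF that] by simp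
    qed
    then show "image_vertex P b ` Q \<subseteq> image_vertex P' b' ` Q'" using * by auto
  qed
  also have "\<dots> \<longleftrightarrow> Q \<subseteq> Q' \<and> (lift \<psi> P b, lift \<psi> P' b') \<in> (glue d aK Q)\<^sup>*"
    using lifted_reachable_iff[OF PP Q(1)] subset_trans[OF _ Q(2), of Q] by auto
  finally show ?thesis by (simp add: A.face_le_unfolding)
qed

lemma face_exists:
  assumes "i \<in> K.C" "prismatic Q" "\<Union>(fst ` Q) \<subseteq> fst i"
  obtains P where "lifted P (snd i)" "snd ` P = fst i" "Q \<subseteq> P"
proof
  let ?P = "ranked (fst i) (coarse_rank Q)"
  show "snd ` ?P = fst i" "Q \<subseteq> ?P"
    using subset_ranked_coarse_rank[OF assms(2,3)] by simp_all
  have "fst i \<in> facets d K" using K.C_coloring assms(1) by blast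
  then show "lifted ?P (snd i)"
    unfolding lifted_def facets_aK_iff snd_ranked using assms(1) by auto
qed

text \<open>All members of a flag are faces of its last member, so they have representatives in one
  common copy \<open>(\<sigma>, b)\<close>; there the flag is one of faces of \<open>\<sigma>\<close>.\<close>

lemma antiprismatic_unfolding:
  "antiprismatic K.U = {image_vertex P b ` Q | P b Q. lifted P b \<and> Q \<subseteq> P \<and> Q \<noteq> {}}"
proof (intro equalityI subsetI)
  fix F assume "F \<in> antiprismatic K.U"
  then show "F \<in> {image_vertex P b ` Q | P b Q. lifted P b \<and> Q \<subseteq> P \<and> Q \<noteq> {}}"
  proof (rule antiprismaticE)
    fix S x and k :: nat
    assume F: "F = {(S i, x i) | i. i \<le> k}"
      and mem: "\<And>i. i \<le> k \<Longrightarrow> S i \<in> simplices K.U \<and> x i \<in> verts K.U (S i)"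
      and flag: "\<And>i j. i \<le> j \<Longrightarrow> j \<le> k \<Longrightarrow> face_le K.U (S i) (S j)"
      and avoid: "\<And>i j. i \<le> k \<Longrightarrow> j \<le> k \<Longrightarrow> face_le K.U (S i) (S j) \<Longrightarrow> S i \<noteq> S j \<Longrightarrow>
        x j \<notin> verts K.U (S i)"
    obtain c T where c: "c \<in> K.C" "T \<subseteq> fst c" "S k = face_class d K c T"
      using mem[of k] unfolding K.simplices_unfolding by blast
    have "\<exists>A v. S i = face_class d K c A \<and> x i = vertex_class d K c v \<and> v \<in> A \<and> A \<subseteq> T"
      if i: "i \<le> k" for i
    proof -
      obtain e A where e: "e \<in> K.C" "S i = face_class d K e A"
        using mem[OF i] unfolding K.simplices_unfolding by blast
      have "A \<subseteq> T \<and> (e, c) \<in> (glue d K A)\<^sup>*"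
        using flag[OF i order_refl] by (simp add: e(2) c(3) K.face_le_unfolding)
      then have "S i = face_class d K c A" "A \<subseteq> T" by (simp_all add: e(2) face_class_eq_iff)
      moreover from this have "x i \<in> vertex_class d K c ` A"
        using mem[OF i] K.verts_unfolding[OF c(1)] by simp
      ultimately show ?thesis by blast
    qed
    then obtain A v where *: "\<And>i. i \<le> k \<Longrightarrow> S i = face_class d K c (A i)"
      "\<And>i. i \<le> k \<Longrightarrow> x i = vertex_class d K c (v i)" "\<And>i. i \<le> k \<Longrightarrow> v i \<in> A i"
      "\<And>i. i \<le> k \<Longrightarrow> A i \<subseteq> T" by metis
    define Q where "Q = (\<lambda>i. (A i, v i)) ` {..k}"
    have le: "face_le K.U (S i) (S j) \<longleftrightarrow> A i \<subseteq> A j" if "i \<le> k" "j \<le> k" for i j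
      using that by (simp add: *(1) K.face_le_unfolding)
    have chain: "A i \<subseteq> A j \<or> A j \<subseteq> A i" if "i \<le> k" "j \<le> k" for i j
      using nat_le_linear[of i j] flag[of i j] flag[of j i] that by (auto simp: le)
    have new: "v j \<notin> A i" if "i \<le> k" "j \<le> k" "A i \<subset> A j" for i j
    proof -
      have "S i \<noteq> S j" using that *(1) by (auto simp: face_class_eq_iff)
      then have "x j \<notin> verts K.U (S i)" using avoid le that by blast
      then show ?thesis using that *(1,2) K.verts_unfolding[OF c(1)] by auto
    qed
    have "prismatic Q"
      unfolding prismatic_def Q_def using *(3) chain new by auto
    moreover have "\<Union>(fst ` Q) \<subseteq> fst c" using *(4) c(2) by (auto simp: Q_def)
    ultimately obtain P where P: "lifted P (snd c)" "snd ` P = fst c" "Q \<subseteq> P"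
      by (rule face_exists[OF c(1)])
    have "F = (\<lambda>i. (S i, x i)) ` {..k}" using F by auto
    also have "\<dots> = image_vertex P (snd c) ` Q"
      unfolding Q_def image_image by (rule image_cong) (auto simp: image_vertex_def P(2) *(1,2))
    finally show ?thesis
      using P Q_def by blast
  qed
next
  fix F assume "F \<in> {image_vertex P b ` Q | P b Q. lifted P b \<and> Q \<subseteq> P \<and> Q \<noteq> {}}"
  then obtain P b Q where F: "F = image_vertex P b ` Q" and P: "lifted P b" and Q: "Q \<subseteq> P" "Q \<noteq> {}"
    by blast
  let ?c = "(snd ` P, b)"
  have c: "?c \<in> K.C" "P \<in> facets d aK" using P by (auto simp: lifted_def)
  have pr: "prismatic Q" by (rule lifted_prismatic[OF P Q(1)])
  have sub: "fst p \<subseteq> snd ` P" if "p \<in> Q" for p using facets_aK(3)[OF c(2)] Q(1) that by blast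
  have fin: "finite (fst p)" if "p \<in> Q" for p
    using sub[OF that] finite_facet[OF facets_aK(1)[OF c(2)]] by (rule finite_subset)
  show "F \<in> antiprismatic K.U"
  proof (rule prismatic_enumerate[OF pr Q(2) fin])
    fix k :: nat and \<tau> w
    assume eq: "Q = {(\<tau> i, w i) | i. i \<le> k}"
      and mono: "\<And>i j. i \<le> j \<Longrightarrow> j \<le> k \<Longrightarrow> \<tau> i \<subseteq> \<tau> j"
    have mem: "(\<tau> i, w i) \<in> Q" if "i \<le> k" for i using eq that by blast
    define S where "S i = face_class d K ?c (\<tau> i)" for i
    define x where "x i = vertex_class d K ?c (w i)" for i
    have w: "w i \<in> \<tau> i" if "i \<le> k" for i using prismaticD(2)[OF pr mem[OF that]] by simp
    have verts: "x j \<in> verts K.U (S i) \<longleftrightarrow> w j \<in> \<tau> i" for i j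
      unfolding S_def x_def K.verts_unfolding[OF c(1)] by (auto simp: vertex_class_eq_iff)
    have le: "face_le K.U (S i) (S j) \<longleftrightarrow> \<tau> i \<subseteq> \<tau> j" for i j
      by (simp add: S_def K.face_le_unfolding)
    have "S i \<in> simplices K.U \<and> x i \<in> verts K.U (S i)" if "i \<le> k" for i
    proof -
      have "\<tau> i \<noteq> {}" "\<tau> i \<subseteq> fst ?c" using w[OF that] sub[OF mem[OF that]] by auto
      then have "S i \<in> simplices K.U"
        unfolding S_def K.simplices_unfolding using c(1) by blast
      then show ?thesis using w[OF that] by (simp add: verts)
    qed
    moreover have "x j \<notin> verts K.U (S i)" if "i \<le> k" "j \<le> k" "face_le K.U (S i) (S j)" "S i \<noteq> S j" for i j
    proof -
      have "\<tau> i \<subset> \<tau> j" using that(3,4) unfolding le by (auto simp: S_def)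
      then show ?thesis
        using prismaticD(4)[OF pr mem[OF that(1)] mem[OF that(2)]] by (simp add: verts)
    qed
    moreover have "F = {(S i, x i) | i. i \<le> k}"
    proof -
      have "Q = (\<lambda>i. (\<tau> i, w i)) ` {..k}" using eq by auto
      then have "F = (\<lambda>i. (S i, x i)) ` {..k}"
        by (simp add: F image_image image_vertex_def S_def x_def)
      then show ?thesis by auto
    qed
    ultimately show ?thesis
      unfolding antiprismatic_def mem_Collect_eq using mono
      by (intro exI[of _ k] exI[of _ S] exI[of _ x]) (simp add: le)
  qed
qed

lemma simplicial_complex_antiprismatic_unfolding: "simplicial_complex (antiprismatic K.U)"
  unfolding simplicial_complex_def
proof (intro ballI conjI allI impI)
  fix F assume "F \<in> antiprismatic K.U"
  then obtain P b Q where F: "F = image_vertex P b ` Q" and P: "lifted P b" and Q: "Q \<subseteq> P" "Q \<noteq> {}"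
    unfolding antiprismatic_unfolding by blast
  show "finite F" "F \<noteq> {}"
    using F Q(2) prismaticD(1)[OF lifted_prismatic[OF P Q(1)]] by auto
  fix G assume "G \<subseteq> F \<and> G \<noteq> {}"
  then obtain Q' where "G = image_vertex P b ` Q'" "Q' \<subseteq> Q" "Q' \<noteq> {}"
    using F by (metis image_is_empty subset_image_iff)
  then show "G \<in> antiprismatic K.U"
    unfolding antiprismatic_unfolding using P Q(1) by blast
qed

definition vertex_map where
  "vertex_map x = (SOME y. \<exists>P b p. lifted P b \<and> p \<in> P \<and>
      x = vertex_class d aK (lift \<psi> P b) p \<and> y = image_vertex P b p)"

lemma vertex_map_class:
  assumes "lifted P b" "p \<in> P"
  shows "vertex_map (vertex_class d aK (lift \<psi> P b) p) = image_vertex P b p"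
  unfolding vertex_map_def
proof (rule some_equality)
  fix y assume "\<exists>P' b' p'. lifted P' b' \<and> p' \<in> P' \<and>
      vertex_class d aK (lift \<psi> P b) p = vertex_class d aK (lift \<psi> P' b') p' \<and>
      y = image_vertex P' b' p'"
  then show "y = image_vertex P b p" using image_vertex_eq_iff_class_eq assms by metis
qed (use assms in blast)

definition simplex_map where "simplex_map s = vertex_map ` verts A.U s"

lemma simplex_map_class:
  assumes "lifted P b" "Q \<subseteq> P"
  shows "simplex_map (face_class d aK (lift \<psi> P b) Q) = image_vertex P b ` Q"
  unfolding simplex_map_def verts_uaK[OF assms(1)] image_image
  using assms by (intro image_cong) (auto simp: vertex_map_class)

lemma vertices_uaK:
  "x \<in> vertices A.U \<longleftrightarrow> (\<exists>P b p. lifted P b \<and> p \<in> P \<and> x = vertex_class d aK (lift \<psi> P b) p)"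
proof
  assume "x \<in> vertices A.U"
  then obtain s where s: "s \<in> simplices A.U" "x \<in> verts A.U s" unfolding vertices_def by blast
  then obtain P b Q where Q: "lifted P b" "Q \<subseteq> P" "s = face_class d aK (lift \<psi> P b) Q"
    unfolding simplices_uaK by blast
  then have "x \<in> vertex_class d aK (lift \<psi> P b) ` Q" using s(2) by (simp add: verts_uaK)
  then show "\<exists>P b p. lifted P b \<and> p \<in> P \<and> x = vertex_class d aK (lift \<psi> P b) p"
    using Q(1,2) by blast
next
  assume "\<exists>P b p. lifted P b \<and> p \<in> P \<and> x = vertex_class d aK (lift \<psi> P b) p"
  then obtain P b p where P: "lifted P b" "p \<in> P" "x = vertex_class d aK (lift \<psi> P b) p" by blast
  then have "face_class d aK (lift \<psi> P b) {p} \<in> simplices A.U" unfolding simplices_uaK by blast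
  moreover have "x \<in> verts A.U (face_class d aK (lift \<psi> P b) {p})" using P by (simp add: verts_uaK)
  ultimately show "x \<in> vertices A.U" unfolding vertices_def by blast
qed

lemma unfold_vertex_map:
  assumes "x \<in> vertices A.U"
  shows "antiprismatic_map unfold_vertex unfold_simplex (vertex_map x) = unfold_vertex x"
proof -
  obtain P b p where "lifted P b" "p \<in> P" "x = vertex_class d aK (lift \<psi> P b) p"
    using assms unfolding vertices_uaK by blast
  then show ?thesis by (simp add: vertex_map_class unfold_image_vertex unfold_vertex_vertex_class)
qed

lemma unfold_simplex_map:
  assumes "s \<in> simplices A.U"
  shows "antiprismatic_map unfold_vertex unfold_simplex ` simplex_map s = unfold_simplex s"
proof -
  obtain P b Q where "lifted P b" "Q \<subseteq> P" "s = face_class d aK (lift \<psi> P b) Q"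
    using assms unfolding simplices_uaK by blast
  then show ?thesis
    by (simp add: simplex_map_class image_image unfold_image_vertex unfold_simplex_face_class)
qed

lemma iso: "pseudo_iso A.U (of_complex (antiprismatic K.U)) vertex_map simplex_map"
proof -
  have le: "simplex_map s \<subseteq> simplex_map t \<longleftrightarrow> face_le A.U s t"
    if st: "s \<in> simplices A.U" "t \<in> simplices A.U" for s t
  proof -
    obtain P b Q where s: "lifted P b" "Q \<subseteq> P" "Q \<noteq> {}" "s = face_class d aK (lift \<psi> P b) Q"
      using st(1) unfolding simplices_uaK by blast
    obtain P' b' Q' where t: "lifted P' b'" "Q' \<subseteq> P'" "t = face_class d aK (lift \<psi> P' b') Q'"
      using st(2) unfolding simplices_uaK by blast
    show ?thesis
      using image_vertex_subset_iff[OF s(1) t(1) s(2) t(2) s(3)] s t by (simp add: simplex_map_class)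
  qed
  have antisym: "s = t"
    if st: "s \<in> simplices A.U" "t \<in> simplices A.U" "face_le A.U s t" "face_le A.U t s" for s t
  proof -
    obtain i Q j Q' where "s = face_class d aK i Q" "t = face_class d aK j Q'"
      using st(1,2) unfolding A.simplices_unfolding by blast
    then show ?thesis using st(3,4) by (simp add: A.face_le_unfolding face_class_eq_iff subset_antisym)
  qed
  have image: "simplex_map ` simplices A.U = antiprismatic K.U"
  proof (intro equalityI subsetI)
    fix F assume "F \<in> simplex_map ` simplices A.U"
    then obtain s where s: "s \<in> simplices A.U" "F = simplex_map s" by blast
    then obtain P b Q where "lifted P b" "Q \<subseteq> P" "Q \<noteq> {}" "s = face_class d aK (lift \<psi> P b) Q"
      unfolding simplices_uaK by blast
    moreover from this have "F = image_vertex P b ` Q" by (simp add: s(2) simplex_map_class)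
    ultimately show "F \<in> antiprismatic K.U" unfolding antiprismatic_unfolding by blast
  next
    fix F assume "F \<in> antiprismatic K.U"
    then obtain P b Q where Q: "lifted P b" "Q \<subseteq> P" "Q \<noteq> {}" "F = image_vertex P b ` Q"
      unfolding antiprismatic_unfolding by blast
    then have "face_class d aK (lift \<psi> P b) Q \<in> simplices A.U" unfolding simplices_uaK by blast
    moreover have "F = simplex_map (face_class d aK (lift \<psi> P b) Q)"
      using Q by (simp add: simplex_map_class)
    ultimately show "F \<in> simplex_map ` simplices A.U" by blast
  qed
  have "inj_on vertex_map (vertices A.U)"
  proof (rule inj_onI)
    fix x y assume xy: "x \<in> vertices A.U" "y \<in> vertices A.U" "vertex_map x = vertex_map y"
    obtain P b p where x: "lifted P b" "p \<in> P" "x = vertex_class d aK (lift \<psi> P b) p"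
      using xy(1) unfolding vertices_uaK by blast
    obtain P' b' p' where y: "lifted P' b'" "p' \<in> P'" "y = vertex_class d aK (lift \<psi> P' b') p'"
      using xy(2) unfolding vertices_uaK by blast
    show "x = y"
      using image_vertex_eq_iff_class_eq[OF x(1) y(1) x(2) y(2)] xy(3)
      by (simp add: x y vertex_map_class)
  qed
  moreover have "vertex_map ` vertices A.U = \<Union>(antiprismatic K.U)"
    unfolding image[symmetric] simplex_map_def vertices_def by blast
  moreover have "inj_on simplex_map (simplices A.U)"
    by (rule inj_onI) (simp add: antisym le[symmetric])
  ultimately show ?thesis
    using image le by (simp add: pseudo_iso_def of_complex_def vertices_def bij_betw_def simplex_map_def)
qed

end

lemma color_permutation:
  assumes P: "bij_betw s P \<sigma>" and b: "bij_betw b \<sigma> {0..d}" and c: "bij_betw c P {0..d::nat}"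
  obtains \<psi> where "bij_betw \<psi> {0..d} {0..d}" "\<And>p. p \<in> P \<Longrightarrow> \<psi> (b (s p)) = c p"
proof
  have bs: "bij_betw (b \<circ> s) P {0..d}" using bij_betw_trans[OF P b] .
  show "bij_betw (c \<circ> inv_into P (b \<circ> s)) {0..d} {0..d}"
    using bij_betw_trans[OF bij_betw_inv_into[OF bs] c] .
  show "(c \<circ> inv_into P (b \<circ> s)) (b (s p)) = c p" if "p \<in> P" for p
    using inv_into_f_f[OF bij_betw_imp_inj_on[OF bs] that] by simp
qed

theorem propositionA1p4:
  fixes K :: "'v set set" and d :: nat
    and \<sigma>\<^sub>0 :: "'v set" and b\<^sub>0 :: "'v \<Rightarrow> nat"
    and \<sigma>\<^sub>1 :: "('v set \<times> 'v) set" and b\<^sub>1 :: "'v set \<times> 'v \<Rightarrow> nat"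
  defines "aK \<equiv> antiprismatic (of_complex K)"
  defines "uK \<equiv> complete_unfolding d K \<sigma>\<^sub>0 b\<^sub>0"
  defines "uaK \<equiv> complete_unfolding d aK \<sigma>\<^sub>1 b\<^sub>1"
  defines "auK \<equiv> of_complex (antiprismatic uK)"
  defines "ap \<equiv> antiprismatic_map unfold_vertex unfold_simplex"
  assumes "simplicial_complex K" "locally_finite K" "pure d K" "strongly_connected d K"
    and "\<sigma>\<^sub>0 \<in> facets d K" "bij_betw b\<^sub>0 \<sigma>\<^sub>0 {0..d}"
    and "\<sigma>\<^sub>1 \<in> facets d aK" "bij_betw b\<^sub>1 \<sigma>\<^sub>1 {0..d}"
  shows "(\<exists>f \<phi>. pseudo_iso uaK auK f \<phi> \<and>
            (\<forall>x\<in>vertices uaK. ap (f x) = unfold_vertex x) \<and>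
            (\<forall>s\<in>simplices uaK. ap ` \<phi> s = unfold_simplex s)) \<and>
         is_simplicial uaK"
proof -
  interpret K: based_unfolding d K \<sigma>\<^sub>0 b\<^sub>0 using assms by unfold_locales
  \<comment> \<open>The shape of the facets of \<open>a(K)\<close> is needed to find the permutation of the colors.\<close>
  interpret id: subdivided_complex d K id using assms by unfold_locales simp_all
  have \<sigma>\<^sub>1: "\<sigma>\<^sub>1 \<in> facets d id.aK" using assms by simp
  have facet: "snd ` \<sigma>\<^sub>1 \<in> facets d K" using id.facets_aK(1)[OF \<sigma>\<^sub>1] .
  obtain \<eta> where \<eta>: "facet_path d K \<eta>" "hd \<eta> = \<sigma>\<^sub>0" "last \<eta> = snd ` \<sigma>\<^sub>1"
    using \<open>strongly_connected d K\<close>[unfolded strongly_connected_def, rule_format,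
        OF \<open>\<sigma>\<^sub>0 \<in> facets d K\<close> facet] by blast
  define b where "b = restrict (b\<^sub>0 \<circ> projectivity (rev \<eta>)) (snd ` \<sigma>\<^sub>1)"
  have b: "(snd ` \<sigma>\<^sub>1, b) \<in> K.C"
    using facet \<eta> by (auto simp: colored_facets_def admissible_def b_def)
  then have "bij_betw b (snd ` \<sigma>\<^sub>1) {0..d}"
    using K.C_coloring by (fastforce simp: coloring_def)
  \<comment> \<open>Some path from \<open>\<sigma>\<^sub>0\<close> to the facet below \<open>\<sigma>\<^sub>1\<close> gives a coloring \<open>b\<close> to compare with \<open>b\<^sub>1\<close>.\<close>
  then obtain \<psi> where \<psi>: "bij_betw \<psi> {0..d} {0..d}" "\<And>p. p \<in> \<sigma>\<^sub>1 \<Longrightarrow> \<psi> (b (snd p)) = b\<^sub>1 p"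
    using color_permutation[OF id.facets_aK_bij[OF \<sigma>\<^sub>1] _ \<open>bij_betw b\<^sub>1 \<sigma>\<^sub>1 {0..d}\<close>] by blast
  have "lift \<psi> \<sigma>\<^sub>1 b = (\<sigma>\<^sub>1, restrict b\<^sub>1 \<sigma>\<^sub>1)"
    using \<psi>(2) by (auto simp: lift_def restrict_def)
  then interpret subdivided_unfolding d K \<sigma>\<^sub>0 b\<^sub>0 \<psi> \<sigma>\<^sub>1 b\<^sub>1
    using b \<psi>(1) \<sigma>\<^sub>1 assms by unfold_locales blast+
  have eqs: "uaK = A.U" "auK = of_complex (antiprismatic K.U)"
    by (simp_all add: uaK_def auK_def aK_def uK_def)
  show ?thesis
    unfolding eqs ap_def
    using iso unfold_vertex_map unfold_simplex_map
      is_simplicial_if_iso_to_complex[OF iso simplicial_complex_antiprismatic_unfolding]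
    by (intro conjI exI[of _ vertex_map] exI[of _ simplex_map]) simp_all
qed

end
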